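(* Let $(\mathbf{d}^+,\mathbf{d}^-)$ be a directed degree sequence with realizations $\vec G_1$ and $\vec G_2$ (on the same labeled vertex set). Then $$\mathbf{dist}_d(\vec G_1,\vec G_2)=H'(\vec G_1,\vec G_2)-\mathbf{maxC}_d(\vec G_1,\vec G_2).$$
   Context: Directed graphs are finite, without loops and without parallel edges (both $xy$ and $yx$ may be present), with labeled vertices $x_1,\dots,x_n$. The directed degree sequence of $\vec G$ is the pair $\big((d_1^+,\dots,d_n^+),(d_1^-,\dots,d_n^-)\big)$ of out-degrees and in-degrees of the vertices; $\vec G$ is then called a realization of this pair. Bipartite representation: $B(\vec G)$ has classes $U=\{u_x\}$ and $W=\{w_x\}$, one copy of each vertex $x$ in each class, and the directed edge $xy$ is represented by the edge $u_xw_y$. The pairs $u_xw_x$ are non-chords (they can never be edges); all other pairs $u_xw_y$ ($x\ne y$) are chords. Swaps: (1) A $C_4$-swap: for distinct $u_x,u_z\in U$ and distinct $w_y,w_t\in W$ such that all four pairs between them are chords, with $u_xw_y,u_zw_t$ edges and $u_xw_t,u_zw_y$ not edges, replace the edges $u_xw_y,u_zw_t$ by $u_xw_t,u_zw_y$ (i.e. replace directed edges $xy,zt$ by $xt,zy$). (2) A triangular $C_6$-swap: for three distinct vertices $x,y,z$ such that $xy,yz,zx$ are directed edges and $yx,zy,xz$ are not, replace $xy,yz,zx$ by $yx,zy,xz$ (reversing an oriented triangle; in the bipartite representation this exchanges the edges and non-edges along a 6-cycle in which the three opposite pairs are non-chords). Only these two types of swaps are allowed. A $C_4$-swap has weight $1$,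 a triangular $C_6$-swap has weight $2$. $\mathbf{dist}_d(\vec G_1,\vec G_2)$ is the minimum total weight of a swap sequence transforming $\vec G_1$ into $\vec G_2$. $H'(\vec G_1,\vec G_2)=|E(\vec G_1)\,\Delta\, E(\vec G_2)|/2$, where $\Delta$ is the symmetric difference of the sets of directed edges. The red-blue directed graph associated with $\vec G_1,\vec G_2$ has the common vertex set, directed edge set $E(\vec G_1)\,\Delta\, E(\vec G_2)$, edges of $E(\vec G_1)\setminus E(\vec G_2)$ red and edges of $E(\vec G_2)\setminus E(\vec G_1)$ blue. It is balanced: at each vertex the red in-degree equals the blue in-degree and the red out-degree equals the blue out-degree. An alternating circuit in it is a closed trail (orientations ignored when traversing, each directed edge used at most once) along which, cyclically, both the colors and the directions alternate: consecutive edges have different colors and are either both directed into or both directed out of their common vertex in the trail (e.g. if $v_iv_{i+1}$ is a red directed edge, then $v_{i+2}v_{i+1}$ is a blue directed edge). Equivalently, it corresponds to a color-alternating closed trail in the bipartite representation. Every balanced red-blue directed graph can be decomposed into alternating circuits, and $\mathbf{maxC}_d(\vec G_1,\vec G_2)$ is the maximum number of circuits in a decomposition of the edge set of the associated red-blue directed graph into alternating circuits. *)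

theory Defs
  imports
    "Graph_Theory.Pair_Digraph"
    "HOL-Library.Disjoint_Sets"
    "HOL-Library.Extended_Real"
begin

text \<open>A directed graph is a \<^locale>\<open>pair_digraph\<close>: finite, loopfree, and with arcs that are
  ordered pairs of vertices, hence without parallel arcs. The vertices themselves serve as labels, so
  a directed degree sequence is a pair of functions on the vertex set.\<close>

definition realization ::
    "'a pair_pre_digraph \<Rightarrow> 'a set \<Rightarrow> ('a \<Rightarrow> nat) \<Rightarrow> ('a \<Rightarrow> nat) \<Rightarrow> bool" where
  "realization G V dout din \<longleftrightarrow>
     pair_digraph G \<and> pverts G = V \<and>
     (\<forall>v\<in>V. out_degree (with_proj G) v = dout v \<and> in_degree (with_proj G) v = din v)"


section \<open>Swaps and swap distance\<close>

text \<open>In the bipartite representation the arc \<open>(x, y)\<close> is the edge between \<open>u\<^sub>x\<close> and \<open>w\<^sub>y\<close>,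
  and such a pair is a chord iff \<open>x \<noteq> y\<close>. The second line of inequalities says that all four pairs
  between \<open>u\<^sub>x, u\<^sub>z\<close> and \<open>w\<^sub>y, w\<^sub>t\<close> are chords.\<close>

definition C4_swap :: "'a pair_pre_digraph \<Rightarrow> 'a pair_pre_digraph \<Rightarrow> bool" where
  "C4_swap G H \<longleftrightarrow> (\<exists>x y z t.
     x \<noteq> z \<and> y \<noteq> t \<and>
     x \<noteq> y \<and> x \<noteq> t \<and> z \<noteq> y \<and> z \<noteq> t \<and>
     (x, y) \<in> parcs G \<and> (z, t) \<in> parcs G \<and> (x, t) \<notin> parcs G \<and> (z, y) \<notin> parcs G \<and>
     H = G\<lparr>parcs := (parcs G - {(x, y), (z, t)}) \<union> {(x, t), (z, y)}\<rparr>)"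

definition triangular_C6_swap :: "'a pair_pre_digraph \<Rightarrow> 'a pair_pre_digraph \<Rightarrow> bool" where
  "triangular_C6_swap G H \<longleftrightarrow> (\<exists>x y z.
     x \<noteq> y \<and> y \<noteq> z \<and> x \<noteq> z \<and>
     (x, y) \<in> parcs G \<and> (y, z) \<in> parcs G \<and> (z, x) \<in> parcs G \<and>
     (y, x) \<notin> parcs G \<and> (z, y) \<notin> parcs G \<and> (x, z) \<notin> parcs G \<and>
     H = G\<lparr>parcs := (parcs G - {(x, y), (y, z), (z, x)}) \<union> {(y, x), (z, y), (x, z)}\<rparr>)"

text \<open>\<open>swap_sequence G w H\<close>: some sequence of swaps of total weight \<open>w\<close> transforms \<open>G\<close> into \<open>H\<close>.\<close>

inductive swap_sequence :: "'a pair_pre_digraph \<Rightarrow> nat \<Rightarrow> 'a pair_pre_digraph \<Rightarrow> bool" where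
  empty: "swap_sequence G 0 G"
| C4: "swap_sequence G w H \<Longrightarrow> C4_swap H K \<Longrightarrow> swap_sequence G (w + 1) K"
| C6: "swap_sequence G w H \<Longrightarrow> triangular_C6_swap H K \<Longrightarrow> swap_sequence G (w + 2) K"

text \<open>Extended naturals, so that the distance would be \<open>\<infinity>\<close> if there were no swap sequence at all.
  The infimum of a nonempty set of extended naturals is attained.\<close>

definition dist_d :: "'a pair_pre_digraph \<Rightarrow> 'a pair_pre_digraph \<Rightarrow> enat" where
  "dist_d G1 G2 = (INF w\<in>{w. swap_sequence G1 w G2}. enat w)"

definition half_hamming :: "'a pair_pre_digraph \<Rightarrow> 'a pair_pre_digraph \<Rightarrow> real" where
  "half_hamming G1 G2 = real (card (sym_diff (parcs G1) (parcs G2))) / 2"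


section \<open>Alternating circuits in the red-blue directed graph\<close>

definition red_arcs :: "'a pair_pre_digraph \<Rightarrow> 'a pair_pre_digraph \<Rightarrow> 'a rel" where
  "red_arcs G1 G2 = parcs G1 - parcs G2"

definition blue_arcs :: "'a pair_pre_digraph \<Rightarrow> 'a pair_pre_digraph \<Rightarrow> 'a rel" where
  "blue_arcs G1 G2 = parcs G2 - parcs G1"

text \<open>A trail may traverse an arc in either direction. A traversal step is an arc together with a
  flag telling whether it is followed along its orientation (\<^const>\<open>True\<close>) or against it.\<close>

type_synonym 'a traversal = "('a \<times> 'a) \<times> bool"

definition origin :: "'a traversal \<Rightarrow> 'a" where
  "origin s = (if snd s then fst (fst s) else snd (fst s))"

definition target :: "'a traversal \<Rightarrow> 'a" where
  "target s = (if snd s then snd (fst s) else fst (fst s))"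

text \<open>Two consecutive arcs are both directed into, or both out of, the common vertex through which
  they are traversed iff exactly one of them is followed along its orientation. Since a step runs
  from \<^const>\<open>origin\<close> to \<^const>\<open>target\<close>, the cyclic condition also covers the closing pair.\<close>

definition alternating_closed_trail :: "'a rel \<Rightarrow> 'a rel \<Rightarrow> 'a traversal list \<Rightarrow> bool" where
  "alternating_closed_trail R B p \<longleftrightarrow>
     p \<noteq> [] \<and> distinct (map fst p) \<and> fst ` set p \<subseteq> R \<union> B \<and>
     (\<forall>i<length p. let s = p ! i; s' = p ! (Suc i mod length p) in
        target s = origin s' \<and>
        (fst s \<in> R \<longleftrightarrow> fst s' \<in> B) \<and>
        (snd s \<longleftrightarrow> \<not> snd s'))"

text \<open>A circuit is identified with its set of arcs.\<close>

definition alternating_circuit :: "'a rel \<Rightarrow> 'a rel \<Rightarrow> 'a rel \<Rightarrow> bool" where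
  "alternating_circuit R B C \<longleftrightarrow> (\<exists>p. alternating_closed_trail R B p \<and> C = fst ` set p)"

definition circuit_decomposition ::
    "'a pair_pre_digraph \<Rightarrow> 'a pair_pre_digraph \<Rightarrow> 'a rel set \<Rightarrow> bool" where
  "circuit_decomposition G1 G2 P \<longleftrightarrow>
     partition_on (red_arcs G1 G2 \<union> blue_arcs G1 G2) P \<and>
     (\<forall>C\<in>P. alternating_circuit (red_arcs G1 G2) (blue_arcs G1 G2) C)"

text \<open>For two realizations of the same degree sequence the set below is finite and nonempty.\<close>

definition maxC_d :: "'a pair_pre_digraph \<Rightarrow> 'a pair_pre_digraph \<Rightarrow> nat" where
  "maxC_d G1 G2 = Max {card P | P. circuit_decomposition G1 G2 P}"

end

theory Submission
  imports Defs
begin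

text \<open>Call a set of red and blue arcs balanced if the red and the blue in- and out-degrees agree at
  every vertex. A nonempty balanced set contains an alternating cycle that is simple in the bipartite
  representation, and alternating circuits are balanced. So a partition into as many nonempty balanced
  sets as possible consists of simple cycles, and circuit decompositions may be replaced by balanced
  partitions.

  A simple cycle of length \<open>2k\<close> is exchanged by swaps of total weight \<open>k - 1\<close>: unless it is a
  triangular 6-cycle, some chord splits it into two shorter cycles. Exchanging the cycles of a
  maximum partition one after the other gives the upper bound on the distance.

  Conversely, let a swap of weight \<open>w\<close> exchange the set \<open>Q\<close> of \<open>2w + 2\<close> arcs. Merging \<open>Q\<close> with the
  parts that meet it yields a balanced partition of the new symmetric difference, and counting shows
  that half its size minus the number of parts grows by at most \<open>w\<close>.\<close>

section \<open>Balanced arc sets\<close>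

text \<open>In this form the signs telescope: those of \<open>E\<close>, \<open>F\<close> and those
  of \<open>F\<close>, \<open>K\<close> add up to those of \<open>E\<close>,
  \<open>K\<close>.\<close>

definition sign_diff :: "'a rel \<Rightarrow> 'a rel \<Rightarrow> 'a \<times> 'a \<Rightarrow> int" where
  "sign_diff E F e = of_bool (e \<in> E) - of_bool (e \<in> F)"

text \<open>\<open>fst\<close> gives the tail, in class U, and \<open>snd\<close> the head, in class
  W. The sign function is a parameter because a swap changes the signs while many parts stay the
  same.\<close>

definition balanced :: "('a \<times> 'a \<Rightarrow> int) \<Rightarrow> 'a rel \<Rightarrow> bool" where
  "balanced s C \<longleftrightarrow>
     (\<forall>v. (\<Sum>e\<in>C. of_bool (fst e = v) * s e) = 0 \<and> (\<Sum>e\<in>C. of_bool (snd e = v) * s e) = 0)"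

lemma balanced_cong:
  assumes "\<And>e. e \<in> C \<Longrightarrow> s e = s' e"
  shows "balanced s C \<longleftrightarrow> balanced s' C"
  using assms by (simp add: balanced_def cong: sum.cong)

section \<open>Closure properties of balanced sets\<close>

lemma balanced_Un:
  assumes "finite C" "finite D" "C \<inter> D = {}" "balanced s C" "balanced s D"
  shows "balanced s (C \<union> D)"
  using assms by (simp add: balanced_def sum.union_disjoint del: sum_of_bool_mult_eq)

lemma balanced_Diff:
  assumes "finite C" "D \<subseteq> C" "balanced s C" "balanced s D"
  shows "balanced s (C - D)"
  using assms by (simp add: balanced_def sum_diff finite_subset del: sum_of_bool_mult_eq)

lemma balanced_Union:
  assumes "finite P" "disjoint P" "\<And>C. C \<in> P \<Longrightarrow> finite C \<and> balanced s C"
  shows "balanced s (\<Union>P)"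
  using assms
proof (induction P rule: finite_induct)
  case empty
  then show ?case by (simp add: balanced_def)
next
  case (insert C P)
  have "C \<inter> \<Union>P = {}"
    using insert.prems(1) insert.hyps(2) by (auto simp: disjoint_def)
  moreover have "balanced s (\<Union>P)" "finite (\<Union>P)"
    using insert by (auto simp: disjoint_def)
  ultimately show ?case
    using insert.prems(2) balanced_Un[of C "\<Union>P" s] by simp
qed

text \<open>Pairs of sign 0 are immaterial, so different sign functions can be compared on one
  common arc set.\<close>

lemma balanced_superset:
  assumes "finite D" "C \<subseteq> D" "\<And>e. e \<in> D - C \<Longrightarrow> s e = 0"
  shows "balanced s D \<longleftrightarrow> balanced s C"
proof -
  have "(\<Sum>e\<in>D. of_bool (\<pi> e = v) * s e) = (\<Sum>e\<in>C. of_bool (\<pi> e = v) * s e)" 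
    for \<pi> :: "'a \<times> 'a \<Rightarrow> 'a" and v
    using assms by (intro sum.mono_neutral_right) auto
  then show ?thesis by (simp add: balanced_def)
qed

lemma balanced_add:
  assumes "balanced s C" "balanced t C"
  shows "balanced (\<lambda>e. s e + t e) C"
  using assms by (simp add: balanced_def distrib_left sum.distrib)

text \<open>Without a negative term all terms would be nonnegative, hence zero. The projection
  \<open>\<pi>\<close> stands for \<open>fst\<close> or \<open>snd\<close>.\<close>

lemma sum_zero_opposite_sign:
  fixes s :: "'b \<Rightarrow> int"
  assumes "finite C" "(\<Sum>e\<in>C. of_bool (\<pi> e = v) * s e) = 0"
    and "e \<in> C" "\<pi> e = v" "s e > 0"
  obtains e' where "e' \<in> C" "\<pi> e' = v" "s e' < 0"
proof (rule ccontr)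
  assume "\<not> thesis"
  with that have "0 \<le> s e'" if "e' \<in> C" "\<pi> e' = v" for e'
    using that by force
  then have "\<forall>e'\<in>C. of_bool (\<pi> e' = v) * s e' = 0"
    using assms(1,2) by (subst (asm) sum_nonneg_eq_0_iff) (auto simp: of_bool_def)
  then show False using assms(3-5) by force
qed

lemma sum_zero_opposite_sign':
  fixes s :: "'b \<Rightarrow> int"
  assumes "finite C" "(\<Sum>e\<in>C. of_bool (\<pi> e = v) * s e) = 0"
    and "e \<in> C" "\<pi> e = v" "s e < 0"
  obtains e' where "e' \<in> C" "\<pi> e' = v" "s e' > 0"
proof (rule sum_zero_opposite_sign[of C \<pi> v "\<lambda>e. - s e" e])
  show "(\<Sum>e\<in>C. of_bool (\<pi> e = v) * - s e) = 0"
    using assms(2) by (simp add: sum_negf)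
qed (use assms that in auto)


section \<open>Simple alternating cycles\<close>

text \<open>The cycle \<open>x\<^sub>0, y\<^sub>0, x\<^sub>1, y\<^sub>1, \<dots>, x\<^sub>k = x\<^sub>0\<close> of the bipartite representation.\<close>

definition cycle_vertices :: "nat \<Rightarrow> (nat \<Rightarrow> 'a) \<Rightarrow> (nat \<Rightarrow> 'a) \<Rightarrow> bool" where
  "cycle_vertices k x y \<longleftrightarrow> 2 \<le> k \<and> inj_on x {..<k} \<and> inj_on y {..<k} \<and> x k = x 0"

definition fwd_arcs :: "nat \<Rightarrow> (nat \<Rightarrow> 'a) \<Rightarrow> (nat \<Rightarrow> 'a) \<Rightarrow> 'a rel" where
  "fwd_arcs k x y = (\<lambda>i. (x i, y i)) ` {..<k}"

text \<open>Tails are always among the x's, so the step from \<open>y i\<close> to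
  \<open>x (Suc i)\<close> runs against the orientation. The last one uses the closing value
  \<open>x k = x 0\<close>.\<close>

definition bwd_arcs :: "nat \<Rightarrow> (nat \<Rightarrow> 'a) \<Rightarrow> (nat \<Rightarrow> 'a) \<Rightarrow> 'a rel" where
  "bwd_arcs k x y = (\<lambda>i. (x (Suc i), y i)) ` {..<k}"

section \<open>Counting and balance of the arcs of a simple cycle\<close>

lemma inj_on_Suc_cyclic:
  assumes "inj_on x {..<k}" "x k = x 0"
  shows "inj_on (\<lambda>i. x (Suc i)) {..<k}"
proof (cases k)
  case (Suc m)
  show ?thesis
  proof (rule inj_onI)
    fix i j assume ij: "i \<in> {..<k}" "j \<in> {..<k}" "x (Suc i) = x (Suc j)"
    \<comment> \<open>Index \<open>k\<close> is replaced by index 0 so that injectivity on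
      \<open>{..<k}\<close> applies.\<close>
    have *: "x (Suc a) = x (if Suc a = k then 0 else Suc a)" for a
      using assms(2) by simp
    have "(if Suc i = k then 0 else Suc i) = (if Suc j = k then 0 else Suc j)"
      using ij by (intro inj_onD[OF assms(1)]) (auto simp: * Suc split: if_splits)
    then show "i = j" by (auto split: if_splits)
  qed
qed simp

lemma card_fwd_arcs: "cycle_vertices k x y \<Longrightarrow> card (fwd_arcs k x y) = k"
  unfolding fwd_arcs_def cycle_vertices_def by (subst card_image) (auto simp: inj_on_def)

lemma card_bwd_arcs: "cycle_vertices k x y \<Longrightarrow> card (bwd_arcs k x y) = k"
  unfolding bwd_arcs_def cycle_vertices_def by (subst card_image) (auto simp: inj_on_def)

text \<open>Equal heads force equal indices, and then two consecutive tails would coincide,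
  contradicting \<open>2 \<le> k\<close>.\<close>

lemma fwd_bwd_arcs_disjoint:
  assumes "cycle_vertices k x y"
  shows "fwd_arcs k x y \<inter> bwd_arcs k x y = {}"
proof -
  have False if "i < k" "j < k" "x i = x (Suc j)" "y i = y j" for i j
  proof -
    have "i = j" using that assms by (auto simp: cycle_vertices_def inj_on_def)
    have "2 \<le> k" "inj_on x {..<k}" "x k = x 0"
      using assms by (auto simp: cycle_vertices_def)
    show False
    proof (cases "Suc j = k")
      case True
      then have "x j = x 0" using that \<open>i = j\<close> \<open>x k = x 0\<close> by metis
      with that \<open>2 \<le> k\<close> True show False
        using inj_onD[OF \<open>inj_on x {..<k}\<close>, of j 0] by auto
    next
      case False
      with that \<open>i = j\<close> show False
        using inj_onD[OF \<open>inj_on x {..<k}\<close>, of j "Suc j"] by auto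
    qed
  qed
  then show ?thesis by (fastforce simp: fwd_arcs_def bwd_arcs_def)
qed

text \<open>At heads the arcs \<open>(x i, y i)\<close> and \<open>(x (Suc i), y i)\<close> cancel
  pairwise; at tails they cancel after a cyclic shift of the index.\<close>

lemma balanced_cycle:
  assumes cyc: "cycle_vertices k x y"
    and fwd: "\<And>e. e \<in> fwd_arcs k x y \<Longrightarrow> s e = 1"
    and bwd: "\<And>e. e \<in> bwd_arcs k x y \<Longrightarrow> s e = -1"
  shows "balanced s (fwd_arcs k x y \<union> bwd_arcs k x y)"
proof -
  have inj: "inj_on (\<lambda>i. (x i, y i)) {..<k}" "inj_on (\<lambda>i. (x (Suc i), y i)) {..<k}"
    using cyc by (auto simp: cycle_vertices_def inj_on_def)
  have "(\<Sum>e\<in>fwd_arcs k x y \<union> bwd_arcs k x y. of_bool (\<pi> e = v) * s e) =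
      (\<Sum>i<k. of_bool (\<pi> (x i, y i) = v)) - (\<Sum>i<k. of_bool (\<pi> (x (Suc i), y i) = v))"
    for \<pi> :: "'a \<times> 'a \<Rightarrow> 'a" and v
  proof -
    have "(\<Sum>e\<in>fwd_arcs k x y \<union> bwd_arcs k x y. of_bool (\<pi> e = v) * s e) =
        (\<Sum>e\<in>fwd_arcs k x y. of_bool (\<pi> e = v) * s e) + (\<Sum>e\<in>bwd_arcs k x y. of_bool (\<pi> e = v) * s e)"
      using fwd_bwd_arcs_disjoint[OF cyc]
      by (intro sum.union_disjoint) (auto simp: fwd_arcs_def bwd_arcs_def)
    also have "(\<Sum>e\<in>fwd_arcs k x y. of_bool (\<pi> e = v) * s e) = (\<Sum>e\<in>fwd_arcs k x y. of_bool (\<pi> e = v))"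
      using fwd by (intro sum.cong) auto
    also have "(\<Sum>e\<in>bwd_arcs k x y. of_bool (\<pi> e = v) * s e) = (\<Sum>e\<in>bwd_arcs k x y. - of_bool (\<pi> e = v))"
      using bwd by (intro sum.cong) auto
    finally show ?thesis
      unfolding fwd_arcs_def bwd_arcs_def sum.reindex[OF inj(1)] sum.reindex[OF inj(2)]
      by (simp add: sum_negf)
  qed
  moreover have "(\<Sum>i<k. of_bool (x (Suc i) = v)) = (\<Sum>i<k. of_bool (x i = v) :: int)" for v
  proof -
    have "(\<Sum>i<k. of_bool (x i = v)) + of_bool (x k = v) =
        of_bool (x 0 = v) + (\<Sum>i<k. of_bool (x (Suc i) = v) :: int)"
      using sum.lessThan_Suc[of "\<lambda>i. of_bool (x i = v) :: int" k]
        sum.lessThan_Suc_shift[of "\<lambda>i. of_bool (x i = v) :: int" k] by linarith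
    then show ?thesis using cyc by (simp add: cycle_vertices_def)
  qed
  ultimately show ?thesis by (simp add: balanced_def)
qed

text \<open>The period is least among all periodic points of \<open>X\<close>: a repetition inside
  the orbit would make another point periodic with a smaller period.\<close>

lemma finite_self_map_cycle:
  assumes "finite X" "X \<noteq> {}" "g ` X \<subseteq> X"
  obtains k z where "0 < k" "z \<in> X" "(g ^^ k) z = z" "inj_on (\<lambda>i. (g ^^ i) z) {..<k}"
proof -
  let ?periodic = "\<lambda>k. 0 < k \<and> (\<exists>z\<in>X. (g ^^ k) z = z)"
  obtain a where "a \<in> X" using assms(2) by blast
  have inX: "(g ^^ i) z \<in> X" if "z \<in> X" for i z
    using that assms(3) by (induction i) auto
  have period: "?periodic (j - i)" if "i < j" "z \<in> X" "(g ^^ i) z = (g ^^ j) z" for i j z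
  proof -
    have "(g ^^ (j - i)) ((g ^^ i) z) = (g ^^ (j - i + i)) z"
      by (simp only: funpow_add o_apply)
    then have "(g ^^ (j - i)) ((g ^^ i) z) = (g ^^ i) z" using that by simp
    then show ?thesis using that inX by auto
  qed
  have "\<not> inj (\<lambda>i. (g ^^ i) a)"
    using inX[OF \<open>a \<in> X\<close>] assms(1)
    by (metis (no_types, lifting) finite_imageD finite_subset image_subsetI infinite_UNIV_nat)
  then obtain i j where "i < j" "(g ^^ i) a = (g ^^ j) a"
    by (metis injI linorder_neqE_nat)
  then have "\<exists>k. ?periodic k" using period \<open>a \<in> X\<close> by blast
  then obtain k where k: "?periodic k" "\<And>k'. k' < k \<Longrightarrow> \<not> ?periodic k'"
    using exists_least_iff[of ?periodic] by auto
  then obtain z where z: "z \<in> X" "(g ^^ k) z = z" by blast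
  have "inj_on (\<lambda>i. (g ^^ i) z) {..<k}"
  proof (rule linorder_inj_onI)
    fix i j assume "i < j" "i \<in> {..<k}" "j \<in> {..<k}"
    then show "(g ^^ i) z \<noteq> (g ^^ j) z"
      using period[of i j z] k(2)[of "j - i"] z(1) by auto
  qed auto
  with k z that show ?thesis by blast
qed

text \<open>Alternately following a chosen positive arc out of a tail and a chosen negative arc back into
  a head is a self-map of the tails of positive arcs; a shortest periodic orbit of it visits each
  copy of a vertex at most once.\<close>

lemma balanced_contains_cycle:
  assumes fin: "finite C" and ne: "C \<noteq> {}" and bal: "balanced s C"
    and sgn: "\<And>e. e \<in> C \<Longrightarrow> s e = 1 \<or> s e = -1"
  obtains k x y where "cycle_vertices k x y"
    "fwd_arcs k x y \<subseteq> {e \<in> C. s e = 1}" "bwd_arcs k x y \<subseteq> {e \<in> C. s e = -1}"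
proof -
  define X where "X = fst ` {e \<in> C. s e = 1}"
  have sum0: "(\<Sum>e\<in>C. of_bool (fst e = v) * s e) = 0" "(\<Sum>e\<in>C. of_bool (snd e = v) * s e) = 0" for v
    using bal by (auto simp: balanced_def)
  have tail: "x \<in> X" if neg: "(x, y) \<in> C" "s (x, y) = -1" for x y
  proof -
    obtain e' where "e' \<in> C" "fst e' = x" "s e' > 0"
      by (rule sum_zero_opposite_sign'[OF fin sum0(1), of "(x, y)" x]) (use neg in simp_all)
    with sgn[of e'] show ?thesis by (force simp: X_def)
  qed
  have returns: "\<exists>x'. (x', y) \<in> C \<and> s (x', y) = -1" if pos: "(x, y) \<in> C" "s (x, y) = 1" for x y
  proof -
    obtain e' where "e' \<in> C" "snd e' = y" "s e' < 0"
      by (rule sum_zero_opposite_sign[OF fin sum0(2), of "(x, y)" y]) (use pos in simp_all)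
    with sgn[of e'] show ?thesis by (cases e') force
  qed
  have "\<forall>x\<in>X. \<exists>y. (x, y) \<in> C \<and> s (x, y) = 1" by (auto simp: X_def)
  then obtain a where a: "\<And>x. x \<in> X \<Longrightarrow> (x, a x) \<in> C \<and> s (x, a x) = 1" by metis
  have "\<forall>y. \<exists>x'. (\<exists>x. (x, y) \<in> C \<and> s (x, y) = 1) \<longrightarrow> (x', y) \<in> C \<and> s (x', y) = -1"
    using returns by blast
  then obtain b where b: "\<And>x y. (x, y) \<in> C \<Longrightarrow> s (x, y) = 1 \<Longrightarrow> (b y, y) \<in> C \<and> s (b y, y) = -1"
    by metis
  have ba: "(b (a x), a x) \<in> C \<and> s (b (a x), a x) = -1" if "x \<in> X" for x
    using a b that by blast
  obtain e where "e \<in> C" using ne by blast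
  then have "X \<noteq> {}" using sgn[of e] tail[of "fst e" "snd e"] 
    by (metis (mono_tags, lifting) X_def empty_iff image_eqI mem_Collect_eq prod.collapse)
  moreover have "finite X" using fin by (simp add: X_def)
  moreover have "(b \<circ> a) ` X \<subseteq> X" using ba tail by auto
  ultimately obtain k z where k: "0 < k" "z \<in> X" "((b \<circ> a) ^^ k) z = z"
      "inj_on (\<lambda>i. ((b \<circ> a) ^^ i) z) {..<k}"
    using finite_self_map_cycle[of X "b \<circ> a"] by blast
  define x where "x i = ((b \<circ> a) ^^ i) z" for i
  have x0: "x 0 = z" and xk: "x k = x 0" and injx: "inj_on x {..<k}" and xS: "x (Suc i) = b (a (x i))" for i
    using k by (auto simp: x_def[abs_def])
  have xX: "x i \<in> X" for i
    by (induction i) (use x0 xS k(2) ba tail in auto)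
  \<comment> \<open>\<open>b\<close> maps these heads to the shifted tails, which are
    distinct.\<close>
  have "inj_on (\<lambda>i. a (x i)) {..<k}"
    using inj_on_Suc_cyclic[OF injx xk] unfolding xS by (auto simp: inj_on_def)
  \<comment> \<open>With \<open>k = 1\<close> one arc would be both positive and negative.\<close>
  moreover have "k \<noteq> 1"
  proof
    assume "k = 1"
    then have "b (a (x 0)) = x 0" using xS[of 0] xk by simp
    then show False using ba[OF xX[of 0]] a[OF xX[of 0]] by simp
  qed
  ultimately have "cycle_vertices k x (\<lambda>i. a (x i))"
    using k(1) xk injx by (simp add: cycle_vertices_def)
  moreover have "fwd_arcs k x (\<lambda>i. a (x i)) \<subseteq> {e \<in> C. s e = 1}"
    using a xX by (auto simp: fwd_arcs_def)
  moreover have "bwd_arcs k x (\<lambda>i. a (x i)) \<subseteq> {e \<in> C. s e = -1}"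
    using ba xX by (auto simp: bwd_arcs_def xS)
  ultimately show ?thesis by (rule that)
qed


section \<open>Circuits\<close>

text \<open>This turns the cycles of a maximum balanced partition back into circuits.\<close>

lemma alternating_circuit_cycle:
  assumes cyc: "cycle_vertices k x y" and disj: "R \<inter> B = {}"
    and fwd: "fwd_arcs k x y \<subseteq> R" and bwd: "bwd_arcs k x y \<subseteq> B"
  shows "alternating_circuit R B (fwd_arcs k x y \<union> bwd_arcs k x y)"
proof -
  \<comment> \<open>Even positions follow forward arcs along their orientation, odd positions
    backward arcs against it.\<close>
  define f where "f i = (if even i then ((x (i div 2), y (i div 2)), True)
      else ((x (Suc (i div 2)), y (i div 2)), False))" for i
  define p where "p = map f [0..<2 * k]"
  have k: "2 \<le> k" and injx: "inj_on x {..<k}" and injy: "inj_on y {..<k}" and xk: "x k = x 0"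
    using cyc by (auto simp: cycle_vertices_def)
  have R: "(x i, y i) \<in> R" "(x i, y i) \<notin> B" if "i < k" for i
    using that fwd disj by (auto simp: fwd_arcs_def)
  have B: "(x (Suc i), y i) \<in> B" "(x (Suc i), y i) \<notin> R" if "i < k" for i
    using that bwd disj by (auto simp: bwd_arcs_def)
  have div: "i div 2 < k" if "i < 2 * k" for i using that by auto
  \<comment> \<open>The color of an arc determines the parity of its position, and its head
    determines the half index.\<close>
  have "inj_on (\<lambda>i. fst (f i)) {..<2 * k}"
  proof (rule inj_onI)
    fix i j assume ij: "i \<in> {..<2 * k}" "j \<in> {..<2 * k}" "fst (f i) = fst (f j)"
    have "even i = even j"
    proof (rule ccontr)
      assume "even i \<noteq> even j"
      then show False
        using ij div[of i] div[of j] R[of "i div 2"] R[of "j div 2"] B[of "i div 2"] B[of "j div 2"]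
        by (auto simp: f_def split: if_splits)
    qed
    moreover have "y (i div 2) = y (j div 2)" using ij by (auto simp: f_def split: if_splits)
    then have "i div 2 = j div 2" using inj_onD[OF injy] ij div by auto
    ultimately show "i = j" by (metis dvd_mult_div_cancel odd_two_times_div_two_succ)
  qed
  then have dist: "distinct (map fst p)"
    by (auto simp: p_def distinct_map comp_def inj_on_def)
  have img: "fst ` set p = fwd_arcs k x y \<union> bwd_arcs k x y"
  proof
    show "fst ` set p \<subseteq> fwd_arcs k x y \<union> bwd_arcs k x y"
      using div by (auto simp: p_def f_def fwd_arcs_def bwd_arcs_def)
    have "(x i, y i) \<in> fst ` set p" "(x (Suc i), y i) \<in> fst ` set p" if "i < k" for i
    proof -
      have "f (2 * i) \<in> set p" "f (Suc (2 * i)) \<in> set p" using that by (auto simp: p_def)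
      then show "(x i, y i) \<in> fst ` set p" "(x (Suc i), y i) \<in> fst ` set p"
        by (force simp: f_def)+
    qed
    then show "fwd_arcs k x y \<union> bwd_arcs k x y \<subseteq> fst ` set p"
      by (auto simp: fwd_arcs_def bwd_arcs_def)
  qed
  have step: "target (f i) = origin (f j) \<and> (fst (f i) \<in> R \<longleftrightarrow> fst (f j) \<in> B) \<and> (snd (f i) \<longleftrightarrow> \<not> snd (f j))"
    if i: "i < 2 * k" and j: "j = Suc i mod (2 * k)" for i j
  proof (cases "even i")
    case True
    then obtain m where m: "i = 2 * m" by blast
    then have "j = Suc (2 * m)" "m < k" using i j by (auto intro: mod_less)
    then show ?thesis using R[of m] B[of m] m by (simp add: f_def target_def origin_def)
  next
    case False
    then obtain m where m: "i = 2 * m + 1" by (rule oddE)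
    then have mk: "m < k" using i by simp
    show ?thesis
    \<comment> \<open>In the first case the position wraps around to 0, and \<open>x k = x 0\<close>
      closes the trail.\<close>
    proof (cases "Suc m = k")
      case True
      then have "j = 0" using m j by auto
      then show ?thesis using R[of 0] B[of m] m mk True xk
        by (auto simp: f_def target_def origin_def)
    next
      case False
      then have "j = 2 * Suc m" "Suc m < k" using m j mk by (auto intro: mod_less)
      then show ?thesis using R[of "Suc m"] B[of m] m mk
        by (simp add: f_def target_def origin_def)
    qed
  qed
  have "target (p ! i) = origin (p ! (Suc i mod length p)) \<and>
      (fst (p ! i) \<in> R \<longleftrightarrow> fst (p ! (Suc i mod length p)) \<in> B) \<and>
      (snd (p ! i) \<longleftrightarrow> \<not> snd (p ! (Suc i mod length p)))" if "i < length p" for i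
  proof -
    have "i < 2 * k" using that by (simp add: p_def)
    moreover have "p ! m = f m" if "m < 2 * k" for m using that by (simp add: p_def)
    moreover have "length p = 2 * k" "Suc i mod (2 * k) < 2 * k" using k by (simp_all add: p_def)
    ultimately show ?thesis using step[OF _ refl, of i] by (simp only:)
  qed
  moreover have "p \<noteq> []" using k by (simp add: p_def)
  moreover have "fst ` set p \<subseteq> R \<union> B" unfolding img using fwd bwd by blast
  ultimately have "alternating_closed_trail R B p"
    using dist unfolding alternating_closed_trail_def Let_def by blast
  then show ?thesis using img by (auto simp: alternating_circuit_def)
qed

lemma sum_cyclic_shift:
  assumes "0 < n"
  shows "(\<Sum>i<n. F (Suc i mod n)) = (\<Sum>i<n. F i :: int)"
proof -
  obtain m where m: "n = Suc m" using assms gr0_conv_Suc by blast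
  have "(\<Sum>i<n. F (Suc i mod n)) = (\<Sum>i<m. F (Suc i mod n)) + F 0"
    by (simp add: m)
  also have "(\<Sum>i<m. F (Suc i mod n)) = (\<Sum>i<m. F (Suc i))"
    by (intro sum.cong) (auto simp: m)
  finally show ?thesis using sum.lessThan_Suc_shift[of F m] by (simp only: m add.commute)
qed

text \<open>The two steps of the trail at a visit of \<open>v\<close> use arcs of opposite sign on the same side of
  \<open>v\<close>, so the contributions cancel after a cyclic shift.\<close>

lemma balanced_alternating_circuit:
  assumes "alternating_circuit R B C"
    and R: "\<And>e. e \<in> R \<Longrightarrow> s e = 1" and B: "\<And>e. e \<in> B \<Longrightarrow> s e = -1"
  shows "balanced s C"
proof -
  obtain p where p: "alternating_closed_trail R B p" and C: "C = fst ` set p"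
    using assms(1) by (auto simp: alternating_circuit_def)
  define n where "n = length p"
  have n: "0 < n" using p by (simp add: alternating_closed_trail_def n_def)
  have step: "target (p ! i) = origin (p ! (Suc i mod n))"
      "snd (p ! i) \<longleftrightarrow> \<not> snd (p ! (Suc i mod n))"
      "s (fst (p ! (Suc i mod n))) = - s (fst (p ! i))" if "i < n" for i
  proof -
    have "p ! i \<in> set p" "p ! (Suc i mod n) \<in> set p"
      using that n by (auto simp: n_def)
    then have mem: "fst (p ! i) \<in> R \<union> B" "fst (p ! (Suc i mod n)) \<in> R \<union> B"
      using p unfolding alternating_closed_trail_def by blast+
    have alt: "target (p ! i) = origin (p ! (Suc i mod n)) \<and>
        (fst (p ! i) \<in> R \<longleftrightarrow> fst (p ! (Suc i mod n)) \<in> B) \<and>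
        (snd (p ! i) \<longleftrightarrow> \<not> snd (p ! (Suc i mod n)))"
      using p that unfolding alternating_closed_trail_def n_def Let_def by blast
    then show "target (p ! i) = origin (p ! (Suc i mod n))"
      "snd (p ! i) \<longleftrightarrow> \<not> snd (p ! (Suc i mod n))" by blast+
    show "s (fst (p ! (Suc i mod n))) = - s (fst (p ! i))"
    proof (cases "fst (p ! i) \<in> R")
      case True
      then show ?thesis using alt R B by simp
    next
      case False
      then have "fst (p ! i) \<in> B" "fst (p ! (Suc i mod n)) \<in> R" using alt mem by auto
      then show ?thesis using R B by simp
    qed
  qed
  have reindex: "(\<Sum>e\<in>C. h e) = (\<Sum>i<n. h (fst (p ! i)))" for h :: "'a \<times> 'a \<Rightarrow> int"
  proof -
    have "C = (\<lambda>i. fst (p ! i)) ` {..<n}"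
    proof -
      have "set p = (\<lambda>i. p ! i) ` {..<n}" by (auto simp: n_def set_conv_nth)
      then show ?thesis by (simp add: C image_image)
    qed
    moreover have "inj_on (\<lambda>i. fst (p ! i)) {..<n}"
      using p by (auto simp: alternating_closed_trail_def n_def distinct_conv_nth inj_on_def)
    ultimately show ?thesis by (simp add: sum.reindex)
  qed
  \<comment> \<open>\<open>d = True\<close> treats the arcs with tail \<open>v\<close>,
    \<open>d = False\<close> those with head \<open>v\<close>.\<close>
  have cancel: "(\<Sum>i<n. of_bool (snd (p ! i) = d \<and> origin (p ! i) = v) * s (fst (p ! i))) +
      (\<Sum>i<n. of_bool (snd (p ! i) \<noteq> d \<and> target (p ! i) = v) * s (fst (p ! i))) = 0"
    for d v
  proof -
    let ?F = "\<lambda>i. of_bool (snd (p ! i) = d \<and> origin (p ! i) = v) * s (fst (p ! i))"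
    have "(\<Sum>i<n. of_bool (snd (p ! i) \<noteq> d \<and> target (p ! i) = v) * s (fst (p ! i)))
        = (\<Sum>i<n. - ?F (Suc i mod n))"
    proof (intro sum.cong refl)
      fix i assume "i \<in> {..<n}"
      then have "i < n" by simp
      from step[OF this] show "of_bool (snd (p ! i) \<noteq> d \<and> target (p ! i) = v) * s (fst (p ! i)) =
          - ?F (Suc i mod n)"
        by (cases "snd (p ! i)"; cases d) simp_all
    qed
    also have "\<dots> = - (\<Sum>i<n. ?F i)"
      unfolding sum_negf sum_cyclic_shift[OF n, of ?F] ..
    finally show ?thesis by simp
  qed
  have "(\<Sum>e\<in>C. of_bool (fst e = v) * s e) = 0" for v
  proof -
    have "(\<Sum>e\<in>C. of_bool (fst e = v) * s e) =
        (\<Sum>i<n. of_bool (snd (p ! i) = True \<and> origin (p ! i) = v) * s (fst (p ! i)) +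
          of_bool (snd (p ! i) \<noteq> True \<and> target (p ! i) = v) * s (fst (p ! i)))"
      unfolding reindex by (intro sum.cong refl) (simp add: origin_def target_def)
    then show ?thesis using cancel[of True v] by (simp only: sum.distrib)
  qed
  moreover have "(\<Sum>e\<in>C. of_bool (snd e = v) * s e) = 0" for v
  proof -
    have "(\<Sum>e\<in>C. of_bool (snd e = v) * s e) =
        (\<Sum>i<n. of_bool (snd (p ! i) = False \<and> origin (p ! i) = v) * s (fst (p ! i)) +
          of_bool (snd (p ! i) \<noteq> False \<and> target (p ! i) = v) * s (fst (p ! i)))"
      unfolding reindex by (intro sum.cong refl) (simp add: origin_def target_def)
    then show ?thesis using cancel[of False v] by (simp only: sum.distrib)
  qed
  ultimately show "balanced s C" unfolding balanced_def by blast
qed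


section \<open>Balanced partitions\<close>

text \<open>Unlike being a circuit, balance survives merging of parts and removal of a balanced
  subset.\<close>

definition balanced_partition :: "'a rel \<Rightarrow> 'a rel \<Rightarrow> 'a rel set \<Rightarrow> bool" where
  "balanced_partition E F P \<longleftrightarrow>
     partition_on (sym_diff E F) P \<and> (\<forall>C\<in>P. balanced (sign_diff E F) C)"

definition alternating_cycle :: "'a rel \<Rightarrow> 'a rel \<Rightarrow> 'a rel \<Rightarrow> bool" where
  "alternating_cycle R B C \<longleftrightarrow> (\<exists>k x y. cycle_vertices k x y \<and>
     fwd_arcs k x y \<subseteq> R \<and> bwd_arcs k x y \<subseteq> B \<and> C = fwd_arcs k x y \<union> bwd_arcs k x y)"

lemma sign_diff_eq:
  "sign_diff E F e = 1 \<longleftrightarrow> e \<in> E - F" "sign_diff E F e = -1 \<longleftrightarrow> e \<in> F - E"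
  "sign_diff E F e = 0 \<longleftrightarrow> e \<notin> sym_diff E F"
  by (auto simp: sign_diff_def of_bool_def)

text \<open>The extracted cycle is itself balanced, so its removal leaves a balanced rest of
  \<open>C\<close>.\<close>

lemma balanced_contains_alternating_cycle:
  assumes "finite C" "C \<noteq> {}" "C \<subseteq> sym_diff E F" "balanced (sign_diff E F) C"
  obtains D where "D \<subseteq> C" "alternating_cycle (E - F) (F - E) D" "balanced (sign_diff E F) D"
    "D \<noteq> {}"
proof -
  obtain k x y where c: "cycle_vertices k x y"
      "fwd_arcs k x y \<subseteq> {e \<in> C. sign_diff E F e = 1}" "bwd_arcs k x y \<subseteq> {e \<in> C. sign_diff E F e = -1}"
    by (rule balanced_contains_cycle[OF assms(1,2,4)]) (use assms(3) in \<open>auto simp: sign_diff_eq\<close>)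
  show ?thesis
  proof (rule that)
    show "alternating_cycle (E - F) (F - E) (fwd_arcs k x y \<union> bwd_arcs k x y)"
      using c unfolding alternating_cycle_def sign_diff_eq by blast
    show "balanced (sign_diff E F) (fwd_arcs k x y \<union> bwd_arcs k x y)"
      by (rule balanced_cycle[OF c(1)]) (use c in auto)
    show "fwd_arcs k x y \<union> bwd_arcs k x y \<noteq> {}"
      using c(1) card_fwd_arcs[OF c(1)] by (auto simp: cycle_vertices_def)
  qed (use c in auto)
qed

section \<open>Circuit decompositions versus maximum balanced partitions\<close>

lemma circuit_decomposition_balanced_partition:
  assumes "circuit_decomposition G H P"
  shows "balanced_partition (parcs G) (parcs H) P"
  unfolding balanced_partition_def
proof (intro conjI ballI)
  show "partition_on (sym_diff (parcs G) (parcs H)) P"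
    using assms by (simp add: circuit_decomposition_def red_arcs_def blue_arcs_def)
  fix C assume "C \<in> P"
  then have "alternating_circuit (red_arcs G H) (blue_arcs G H) C"
    using assms by (simp add: circuit_decomposition_def)
  then show "balanced (sign_diff (parcs G) (parcs H)) C"
    by (rule balanced_alternating_circuit)
      (simp_all only: sign_diff_eq red_arcs_def blue_arcs_def)
qed

text \<open>Any other part could be split into a cycle inside it and the balanced rest, giving one
  part more.\<close>

lemma max_balanced_partition_cycles:
  assumes fin: "finite E" "finite F" and P: "balanced_partition E F P"
    and max: "\<And>Q. balanced_partition E F Q \<Longrightarrow> card Q \<le> card P"
    and C: "C \<in> P"
  shows "alternating_cycle (E - F) (F - E) C"
proof -
  have part: "partition_on (sym_diff E F) P" and bal: "\<And>D. D \<in> P \<Longrightarrow> balanced (sign_diff E F) D"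
    using P by (auto simp: balanced_partition_def)
  have CE: "C \<subseteq> sym_diff E F" "C \<noteq> {}"
    using part C by (auto simp: partition_on_def)
  moreover have finC: "finite C" using CE(1) fin finite_subset by blast
  ultimately obtain D where D: "D \<subseteq> C" "alternating_cycle (E - F) (F - E) D"
      "balanced (sign_diff E F) D" "D \<noteq> {}"
    using balanced_contains_alternating_cycle bal[OF C] by metis
  have "C - D = {}"
  proof (rule ccontr)
    assume ne: "C - D \<noteq> {}"
    have finP: "finite P" using part fin by (intro finite_elements[of "sym_diff E F"]) auto
    have disj: "X \<inter> C = {}" if "X \<in> P - {C}" for X
      using that part C by (auto simp: partition_on_def disjoint_def)
    \<comment> \<open>The two pieces are not among the other parts, so the split really raises the
      count.\<close>
    have notin: "X \<notin> P - {C}" if "X \<subseteq> C" "X \<noteq> {}" for X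
      using that disj by blast
    have "disjoint ((P - {C}) \<union> {D, C - D})"
    proof (rule disjoint_union)
      show "disjoint (P - {C})" using part by (auto simp: partition_on_def disjoint_def)
      show "disjoint {D, C - D}" by (auto simp: disjoint_def)
      show "\<Union>(P - {C}) \<inter> \<Union>{D, C - D} = {}" using disj D(1) by blast
    qed
    moreover have "\<Union>((P - {C}) \<union> {D, C - D}) = sym_diff E F"
    proof -
      have "\<Union>((P - {C}) \<union> {D, C - D}) = \<Union>P" using C D(1) by blast
      then show ?thesis using part by (simp add: partition_on_def)
    qed
    moreover have "{} \<notin> (P - {C}) \<union> {D, C - D}"
      using part ne D(4) by (auto simp: partition_on_def)
    ultimately have "partition_on (sym_diff E F) ((P - {C}) \<union> {D, C - D})"
      unfolding partition_on_def by blast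
    then have "balanced_partition E F ((P - {C}) \<union> {D, C - D})"
      using D(3) bal balanced_Diff[OF finC D(1) bal[OF C] D(3)]
      unfolding balanced_partition_def by blast
    then have "card ((P - {C}) \<union> {D, C - D}) \<le> card P" by (rule max)
    moreover have "card ((P - {C}) \<union> {D, C - D}) = card (P - {C}) + card {D, C - D}"
      using finP notin D ne by (intro card_Un_disjoint) auto
    moreover have "D \<noteq> C - D" using D(4) by blast
    then have "card {D, C - D} = 2" by simp
    moreover have "card (P - {C}) = card P - 1" "0 < card P"
      using C finP by (auto simp: card_gt_0_iff)
    ultimately show False by simp
  qed
  then show ?thesis using D by (metis Diff_eq_empty_iff subset_antisym)
qed

lemma max_balanced_partition_exists:
  assumes "finite E" "finite F" "balanced (sign_diff E F) (sym_diff E F)"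
  obtains P where "balanced_partition E F P" "\<And>Q. balanced_partition E F Q \<Longrightarrow> card Q \<le> card P"
proof -
  let ?A = "sym_diff E F"
  have "{Q. balanced_partition E F Q} \<subseteq> Pow (Pow ?A)"
    by (auto simp: balanced_partition_def partition_on_def)
  then have fin: "finite {Q. balanced_partition E F Q}"
    using assms(1,2) finite_subset by blast
  \<comment> \<open>The empty set may not be a part, so an empty difference needs the empty
    partition.\<close>
  have "partition_on ?A (if ?A = {} then {} else {?A})"
    by (auto simp: partition_on_def disjoint_def)
  then have "balanced_partition E F (if ?A = {} then {} else {?A})"
    using assms(3) unfolding balanced_partition_def by simp
  then have ne: "{Q. balanced_partition E F Q} \<noteq> {}" by blast
  have "Max (card ` {Q. balanced_partition E F Q}) \<in> card ` {Q. balanced_partition E F Q}"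
    using fin ne by (intro Max_in) auto
  then obtain P where "balanced_partition E F P" "card P = Max (card ` {Q. balanced_partition E F Q})"
    by auto
  moreover have "card Q \<le> Max (card ` {Q. balanced_partition E F Q})" if "balanced_partition E F Q" for Q
    using that fin by (intro Max_ge) auto
  ultimately show ?thesis using that by metis
qed

text \<open>The parts of a maximum balanced partition are circuits, and every circuit decomposition
  is a balanced partition, so the two maxima agree.\<close>

lemma maxC_d_eq:
  assumes fin: "finite (parcs G)" "finite (parcs H)"
    and P: "balanced_partition (parcs G) (parcs H) P"
    and max: "\<And>Q. balanced_partition (parcs G) (parcs H) Q \<Longrightarrow> card Q \<le> card P"
  shows "maxC_d G H = card P"
proof -
  have "alternating_circuit (red_arcs G H) (blue_arcs G H) C" if "C \<in> P" for C
  proof -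
    have "alternating_cycle (red_arcs G H) (blue_arcs G H) C"
      using max_balanced_partition_cycles[OF fin P max that] by (simp add: red_arcs_def blue_arcs_def)
    moreover have "red_arcs G H \<inter> blue_arcs G H = {}" by (auto simp: red_arcs_def blue_arcs_def)
    ultimately show ?thesis using alternating_circuit_cycle by (auto simp: alternating_cycle_def)
  qed
  then have "circuit_decomposition G H P"
    using P by (simp add: circuit_decomposition_def balanced_partition_def red_arcs_def blue_arcs_def)
  moreover have "finite {card P | P. circuit_decomposition G H P}"
    by (rule finite_subset[of _ "{..card P}"])
      (auto intro: max circuit_decomposition_balanced_partition)
  ultimately show ?thesis
    unfolding maxC_d_def
    by (intro Max_eqI) (auto intro: max circuit_decomposition_balanced_partition)
qed


section \<open>Swapping along a cycle\<close>

lemma swap_sequence_trans: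
  assumes "swap_sequence G v H" "swap_sequence H w K"
  shows "swap_sequence G (v + w) K"
  using assms(2,1)
proof (induction rule: swap_sequence.induct)
  case (C4 H w L K)
  then show ?case using swap_sequence.C4[of G "v + w" L K] by (simp add: add.assoc)
next
  case (C6 H w L K)
  then show ?case using swap_sequence.C6[of G "v + w" L K] by (simp only: add.assoc)
qed simp

text \<open>Quantifying over all \<open>G\<close> makes this a property of the two arc sets alone,
  usable at every intermediate graph of a swap sequence.\<close>

definition exchangeable :: "'a rel \<Rightarrow> 'a rel \<Rightarrow> nat \<Rightarrow> bool" where
  "exchangeable R B w \<longleftrightarrow> (\<forall>G. R \<subseteq> parcs G \<and> B \<inter> parcs G = {} \<longrightarrow>
     swap_sequence G w (G\<lparr>parcs := parcs G - R \<union> B\<rparr>))"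

lemma exchangeableD:
  assumes "exchangeable R B w" "R \<subseteq> parcs G" "B \<inter> parcs G = {}" "A = parcs G - R \<union> B"
  shows "swap_sequence G w (G\<lparr>parcs := A\<rparr>)"
  using assms unfolding exchangeable_def by blast

section \<open>Exchanging 4-cycles and 6-cycles\<close>

lemma exchangeable_4_cycle:
  fixes x0 :: 'a
  assumes "x0 \<noteq> x1" "y0 \<noteq> y1" "x0 \<noteq> y0" "x1 \<noteq> y1" "x1 \<noteq> y0" "x0 \<noteq> y1"
  shows "exchangeable {(x0, y0), (x1, y1)} {(x1, y0), (x0, y1)} 1"
  unfolding exchangeable_def
proof (intro allI impI)
  fix G :: "'a pair_pre_digraph"
  assume G: "{(x0, y0), (x1, y1)} \<subseteq> parcs G \<and> {(x1, y0), (x0, y1)} \<inter> parcs G = {}"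
  have "C4_swap G (G\<lparr>parcs := parcs G - {(x0, y0), (x1, y1)} \<union> {(x1, y0), (x0, y1)}\<rparr>)"
    unfolding C4_swap_def using G assms
    by (intro exI[of _ x0] exI[of _ y0] exI[of _ x1] exI[of _ y1]) (auto simp: insert_commute)
  from swap_sequence.C4[OF swap_sequence.empty this]
  show "swap_sequence G 1 (G\<lparr>parcs := parcs G - {(x0, y0), (x1, y1)} \<union> {(x1, y0), (x0, y1)}\<rparr>)"
    by simp
qed

text \<open>The chord \<open>c\<close> splits a cycle into two. If \<open>c\<close> is absent, the half in which \<open>c\<close> gets inserted
  is exchanged first; otherwise the other half.\<close>

lemma exchangeable_split:
  assumes ex1: "exchangeable R1 (insert c B1) v" and ex2: "exchangeable (insert c R2) B2 w"
    and c: "c \<notin> R1 \<union> R2 \<union> B1 \<union> B2"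
    and disj: "R1 \<inter> R2 = {}" "B1 \<inter> B2 = {}" "(R1 \<union> R2) \<inter> (B1 \<union> B2) = {}"
  shows "exchangeable (R1 \<union> R2) (B1 \<union> B2) (v + w)"
  unfolding exchangeable_def
proof (intro allI impI)
  fix G :: "'a pair_pre_digraph"
  assume G: "R1 \<union> R2 \<subseteq> parcs G \<and> (B1 \<union> B2) \<inter> parcs G = {}"
  let ?K = "G\<lparr>parcs := parcs G - (R1 \<union> R2) \<union> (B1 \<union> B2)\<rparr>"
  show "swap_sequence G (v + w) ?K"
  proof (cases "c \<in> parcs G")
    case False
    let ?H = "G\<lparr>parcs := parcs G - R1 \<union> insert c B1\<rparr>"
    have "swap_sequence G v ?H"
      by (rule exchangeableD[OF ex1]) (use G False in auto)
    moreover have "swap_sequence ?H w (?H\<lparr>parcs := parcs ?K\<rparr>)"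
    proof (rule exchangeableD[OF ex2])
      show "insert c R2 \<subseteq> parcs ?H" using G disj by auto
      show "B2 \<inter> parcs ?H = {}" using G disj c by auto
      show "parcs ?K = parcs ?H - insert c R2 \<union> B2" using G disj c False by auto
    qed
    ultimately have "swap_sequence G (v + w) (?H\<lparr>parcs := parcs ?K\<rparr>)" by (rule swap_sequence_trans)
    then show ?thesis by simp
  next
    case True
    let ?H = "G\<lparr>parcs := parcs G - insert c R2 \<union> B2\<rparr>"
    have "swap_sequence G w ?H"
      by (rule exchangeableD[OF ex2]) (use G True in auto)
    moreover have "swap_sequence ?H v (?H\<lparr>parcs := parcs ?K\<rparr>)"
    proof (rule exchangeableD[OF ex1])
      show "R1 \<subseteq> parcs ?H" using G disj c by auto
      show "insert c B1 \<inter> parcs ?H = {}" using G disj c by auto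
      show "parcs ?K = parcs ?H - R1 \<union> insert c B1" using G disj c True by auto
    qed
    ultimately have "swap_sequence G (w + v) (?H\<lparr>parcs := parcs ?K\<rparr>)" by (rule swap_sequence_trans)
    then show ?thesis by (simp add: add.commute)
  qed
qed

text \<open>The chord \<open>(x0, y1)\<close> cuts the 6-cycle into two 4-cycles of weight 1
  each.\<close>

lemma exchangeable_6_cycle_chord:
  assumes "distinct [x0, x1, x2]" "distinct [y0, y1, y2]"
    and "x0 \<noteq> y0" "x1 \<noteq> y1" "x2 \<noteq> y2" "x1 \<noteq> y0" "x2 \<noteq> y1" "x0 \<noteq> y2"
    and "x0 \<noteq> y1"
  shows "exchangeable {(x0, y0), (x1, y1), (x2, y2)} {(x1, y0), (x2, y1), (x0, y2)} 2"
proof -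
  have "exchangeable {(x0, y0), (x1, y1)} (insert (x0, y1) {(x1, y0)}) 1"
    using exchangeable_4_cycle[of x0 x1 y0 y1] assms by (simp add: insert_commute)
  moreover have "exchangeable (insert (x0, y1) {(x2, y2)}) {(x2, y1), (x0, y2)} 1"
    using exchangeable_4_cycle[of x0 x2 y1 y2] assms by (simp add: insert_commute)
  ultimately have "exchangeable ({(x0, y0), (x1, y1)} \<union> {(x2, y2)}) ({(x1, y0)} \<union> {(x2, y1), (x0, y2)}) (1 + 1)"
    by (rule exchangeable_split) (use assms in auto)
  then show ?thesis by (simp add: numeral_2_eq_2 insert_commute)
qed

text \<open>If none of the opposite pairs \<open>(x0, y1)\<close>, \<open>(x1, y2)\<close>,
  \<open>(x2, y0)\<close> is a chord, the cycle is an oriented triangle; otherwise a rotation moves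
  a chord into the place of \<open>(x0, y1)\<close>.\<close>

lemma exchangeable_6_cycle:
  fixes x0 :: 'a
  assumes "distinct [x0, x1, x2]" "distinct [y0, y1, y2]"
    and "x0 \<noteq> y0" "x1 \<noteq> y1" "x2 \<noteq> y2" "x1 \<noteq> y0" "x2 \<noteq> y1" "x0 \<noteq> y2"
  shows "exchangeable {(x0, y0), (x1, y1), (x2, y2)} {(x1, y0), (x2, y1), (x0, y2)} 2"
proof (cases "x0 = y1 \<and> x1 = y2 \<and> x2 = y0")
  case True
  show ?thesis
    unfolding exchangeable_def
  proof (intro allI impI)
    fix G :: "'a pair_pre_digraph"
  assume G: "{(x0, y0), (x1, y1), (x2, y2)} \<subseteq> parcs G \<and>
      {(x1, y0), (x2, y1), (x0, y2)} \<inter> parcs G = {}"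
    \<comment> \<open>The triangle runs through \<open>x0\<close>, \<open>x2\<close>,
      \<open>x1\<close>, since \<open>y0 = x2\<close>, \<open>y2 = x1\<close> and
      \<open>y1 = x0\<close>.\<close>
    have "triangular_C6_swap G
        (G\<lparr>parcs := parcs G - {(x0, y0), (x1, y1), (x2, y2)} \<union> {(x1, y0), (x2, y1), (x0, y2)}\<rparr>)"
      unfolding triangular_C6_swap_def using G True assms
      by (intro exI[of _ x0] exI[of _ x2] exI[of _ x1]) (auto simp: insert_commute)
    from swap_sequence.C6[OF swap_sequence.empty this]
    show "swap_sequence G 2
        (G\<lparr>parcs := parcs G - {(x0, y0), (x1, y1), (x2, y2)} \<union> {(x1, y0), (x2, y1), (x0, y2)}\<rparr>)"
      by (simp only: add_0)
  qed
next
  case False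
  then consider "x0 \<noteq> y1" | "x1 \<noteq> y2" | "x2 \<noteq> y0" by blast
  then show ?thesis
  proof cases
    case 1
    then show ?thesis using exchangeable_6_cycle_chord[of x0 x1 x2 y0 y1 y2] assms by simp
  next
    case 2
    have "exchangeable {(x1, y1), (x2, y2), (x0, y0)} {(x2, y1), (x0, y2), (x1, y0)} 2"
      by (rule exchangeable_6_cycle_chord) (use 2 assms in auto)
    then show ?thesis by (simp add: insert_commute)
  next
    case 3
    have "exchangeable {(x2, y2), (x0, y0), (x1, y1)} {(x0, y2), (x1, y0), (x2, y1)} 2"
      by (rule exchangeable_6_cycle_chord) (use 3 assms in auto)
    then show ?thesis by (simp add: insert_commute)
  qed
qed

text \<open>The chord \<open>(x 0, y j)\<close> closes the segment up to \<open>y j\<close> as a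
  backward arc and opens the remaining segment as a forward arc. The updates put \<open>x 0\<close>
  at position \<open>Suc j\<close> of the first cycle and at position 0 of the second.\<close>

lemma exchangeable_cycle_split:
  assumes cyc: "cycle_vertices k x y"
    and j: "0 < j" "Suc j < k"
    and ex1: "exchangeable (fwd_arcs (Suc j) (x(Suc j := x 0)) y)
      (bwd_arcs (Suc j) (x(Suc j := x 0)) y) v"
    and ex2: "exchangeable (fwd_arcs (k - j) ((\<lambda>i. x (i + j))(0 := x 0)) (\<lambda>i. y (i + j)))
      (bwd_arcs (k - j) ((\<lambda>i. x (i + j))(0 := x 0)) (\<lambda>i. y (i + j))) w"
  shows "exchangeable (fwd_arcs k x y) (bwd_arcs k x y) (v + w)"
proof -
  let ?f = "\<lambda>i. (x i, y i)" and ?b = "\<lambda>i. (x (Suc i), y i)"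
  have inj: "inj_on ?f {..<k}" "inj_on ?b {..<k}" and injx: "inj_on x {..<k}" and injy: "inj_on y {..<k}"
    and xk: "x k = x 0"
    using cyc by (auto simp: cycle_vertices_def inj_on_def)
  \<comment> \<open>The bounds on \<open>j\<close> exclude exactly the neighbours \<open>y 0\<close>
    and \<open>y (k - 1)\<close> of \<open>x 0\<close> on the cycle.\<close>
  have c: "(x 0, y j) \<noteq> ?f i" "(x 0, y j) \<noteq> ?b i" if "i < k" for i
  proof -
    show "(x 0, y j) \<noteq> ?f i"
      using that j inj_onD[OF injx, of 0 i] inj_onD[OF injy, of j i] by auto
    show "(x 0, y j) \<noteq> ?b i"
      using that j inj_onD[OF injx, of 0 "Suc i"] inj_onD[OF injy, of j i] by auto
  qed
  have shift: "(\<lambda>i. g (i + j)) ` {a..<k - j} = g ` {a + j..<k}" for g :: "nat \<Rightarrow> 'a \<times> 'a" and a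
  proof -
    have "(\<lambda>i. g (i + j)) ` {a..<k - j} = g ` ((\<lambda>i. i + j) ` {a..<k - j})"
      by (simp only: image_image)
    also have "(\<lambda>i. i + j) ` {a..<k - j} = {a + j..<k}"
      unfolding image_add_atLeastLessThan' using j by simp
    finally show ?thesis .
  qed
  \<comment> \<open>The update at \<open>Suc j\<close> affects only the last backward arc, which
    becomes the chord.\<close>
  have f1: "fwd_arcs (Suc j) (x(Suc j := x 0)) y = ?f ` {..<Suc j}"
    unfolding fwd_arcs_def by (intro image_cong) auto
  have b1: "bwd_arcs (Suc j) (x(Suc j := x 0)) y = insert (x 0, y j) (?b ` {..<j})"
    unfolding bwd_arcs_def lessThan_Suc image_insert by (intro arg_cong2[of _ _ _ _ insert] image_cong) auto
  \<comment> \<open>Index 0 is the only one with a changed tail; its forward arc is the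
    chord.\<close>
  have split0: "{..<k - j} = insert 0 {1..<k - j}" using j by auto
  have f2: "fwd_arcs (k - j) ((\<lambda>i. x (i + j))(0 := x 0)) (\<lambda>i. y (i + j)) =
      insert (x 0, y j) (?f ` {Suc j..<k})"
    unfolding fwd_arcs_def split0 image_insert using shift[of ?f 1]
    by (intro arg_cong2[of _ _ _ _ insert]) (auto cong: image_cong_simp)
  have b2: "bwd_arcs (k - j) ((\<lambda>i. x (i + j))(0 := x 0)) (\<lambda>i. y (i + j)) = ?b ` {j..<k}"
    unfolding bwd_arcs_def lessThan_atLeast0 using shift[of ?b 0] by simp
  have subsets: "?f ` {..<Suc j} \<union> ?f ` {Suc j..<k} \<subseteq> ?f ` {..<k}"
    "?b ` {..<j} \<union> ?b ` {j..<k} \<subseteq> ?b ` {..<k}"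
    using j by (auto intro!: image_mono)
  have "exchangeable (?f ` {..<Suc j} \<union> ?f ` {Suc j..<k}) (?b ` {..<j} \<union> ?b ` {j..<k}) (v + w)"
  proof (rule exchangeable_split[OF ex1[unfolded f1 b1] ex2[unfolded f2 b2]])
    show "(x 0, y j) \<notin> ?f ` {..<Suc j} \<union> ?f ` {Suc j..<k} \<union> ?b ` {..<j} \<union> ?b ` {j..<k}"
      using c subsets by blast
    show "?f ` {..<Suc j} \<inter> ?f ` {Suc j..<k} = {}"
      using j by (subst inj_on_image_Int[OF inj(1), symmetric]) auto
    show "?b ` {..<j} \<inter> ?b ` {j..<k} = {}"
      using j by (subst inj_on_image_Int[OF inj(2), symmetric]) auto
    show "(?f ` {..<Suc j} \<union> ?f ` {Suc j..<k}) \<inter> (?b ` {..<j} \<union> ?b ` {j..<k}) = {}"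
      using Int_mono[OF subsets] fwd_bwd_arcs_disjoint[OF cyc] by (simp only: fwd_arcs_def bwd_arcs_def subset_empty)
  qed
  moreover have "{..<Suc j} \<union> {Suc j..<k} = {..<k}" "{..<j} \<union> {j..<k} = {..<k}"
    using j by auto
  ultimately show ?thesis by (simp only: fwd_arcs_def bwd_arcs_def image_Un[symmetric])
qed

text \<open>Strong induction on half the length. The case \<open>k = 3\<close> is a base case
  because a 6-cycle may have no chord to split along.\<close>

lemma exchangeable_cycle:
  assumes "cycle_vertices k x y" "\<And>i. i < k \<Longrightarrow> x i \<noteq> y i" "\<And>i. i < k \<Longrightarrow> x (Suc i) \<noteq> y i"
  shows "exchangeable (fwd_arcs k x y) (bwd_arcs k x y) (k - 1)"
  using assms
proof (induction k arbitrary: x y rule: less_induct)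
  case (less k)
  have k: "2 \<le> k" and injx: "inj_on x {..<k}" and injy: "inj_on y {..<k}" and xk: "x k = x 0"
    using less.prems(1) by (auto simp: cycle_vertices_def)
  have neq: "x i \<noteq> x j" "y i \<noteq> y j" if "i < k" "j < k" "i \<noteq> j" for i j
    using that inj_onD[OF injx, of i j] inj_onD[OF injy, of i j] by auto
  consider "k = 2" | "k = 3" | "4 \<le> k" using k by linarith
  then show ?case
  proof cases
    case 1
    have "{..<k} = {0, 1}" using 1 by auto
    moreover have "exchangeable {(x 0, y 0), (x 1, y 1)} {(x 1, y 0), (x 0, y 1)} 1"
      using neq[of 0 1] less.prems(2)[of 0] less.prems(2)[of 1] less.prems(3)[of 0] less.prems(3)[of 1]
        xk 1 by (intro exchangeable_4_cycle) (auto simp: numeral_2_eq_2)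
    ultimately show ?thesis using 1 xk by (simp add: fwd_arcs_def bwd_arcs_def numeral_2_eq_2)
  next
    case 2
    have "{..<k} = {0, 1, 2}" using 2 by auto
    moreover have "exchangeable {(x 0, y 0), (x 1, y 1), (x 2, y 2)} {(x 1, y 0), (x 2, y 1), (x 0, y 2)} 2"
      using neq[of 0 1] neq[of 0 2] neq[of 1 2] less.prems(2)[of 0] less.prems(2)[of 1] less.prems(2)[of 2]
        less.prems(3)[of 0] less.prems(3)[of 1] less.prems(3)[of 2] xk 2
      by (intro exchangeable_6_cycle) (auto simp: numeral_2_eq_2 numeral_3_eq_3)
    ultimately show ?thesis using 2 xk by (simp add: fwd_arcs_def bwd_arcs_def numeral_2_eq_2 numeral_3_eq_3)
  next
    case 3
    \<comment> \<open>Neither \<open>y\<^sub>1\<close> nor \<open>y\<^sub>2\<close> is next to \<open>x\<^sub>0\<close> on the cycle, and at most one of them is the same vertex.\<close>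
    have "y 1 \<noteq> y 2" using neq[of 1 2] 3 by simp
    then obtain j where j: "j = 1 \<or> j = 2" and chord: "x 0 \<noteq> y j" by metis
    have jk: "0 < j" "Suc j < k" using j 3 by auto
    \<comment> \<open>The chord is counted in both smaller cycles, and their weights
      \<open>j\<close> and \<open>k - j - 1\<close> add up to \<open>k - 1\<close>.\<close>
    have "exchangeable (fwd_arcs k x y) (bwd_arcs k x y) ((Suc j - 1) + (k - j - 1))"
    proof (rule exchangeable_cycle_split[OF less.prems(1) jk])
      show "exchangeable (fwd_arcs (Suc j) (x(Suc j := x 0)) y) (bwd_arcs (Suc j) (x(Suc j := x 0)) y)
          (Suc j - 1)"
      proof (rule less.IH)
        show "cycle_vertices (Suc j) (x(Suc j := x 0)) y"
          using jk injx injy by (auto simp: cycle_vertices_def inj_on_def)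
        show "(x(Suc j := x 0)) i \<noteq> y i" "(x(Suc j := x 0)) (Suc i) \<noteq> y i" if "i < Suc j" for i
          using that jk chord less.prems(2)[of i] less.prems(3)[of i] by auto
      qed (use jk in simp)
      let ?x = "(\<lambda>i. x (i + j))(0 := x 0)"
      show "exchangeable (fwd_arcs (k - j) ?x (\<lambda>i. y (i + j))) (bwd_arcs (k - j) ?x (\<lambda>i. y (i + j)))
          (k - j - 1)"
      proof (rule less.IH)
        have "inj_on ?x {..<k - j}"
        proof (rule linorder_inj_onI)
          fix a b assume "a < b" "a \<in> {..<k - j}" "b \<in> {..<k - j}"
          then have "0 < b" "b + j < k" "a < b" by auto
          then show "?x a \<noteq> ?x b"
            using jk neq(1)[of "if a = 0 then 0 else a + j" "b + j"] by auto
        qed auto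
        moreover have "inj_on (\<lambda>i. y (i + j)) {..<k - j}"
        proof (rule linorder_inj_onI)
          fix a b assume "a < b" "a \<in> {..<k - j}" "b \<in> {..<k - j}"
          then have "b + j < k" "a < b" by auto
          then show "y (a + j) \<noteq> y (b + j)" using neq(2)[of "a + j" "b + j"] by auto
        qed auto
        ultimately show "cycle_vertices (k - j) ?x (\<lambda>i. y (i + j))"
          using jk xk by (auto simp: cycle_vertices_def)
        show "?x i \<noteq> y (i + j)" "?x (Suc i) \<noteq> y (i + j)" if "i < k - j" for i
          using that jk chord less.prems(2)[of "i + j"] less.prems(3)[of "i + j"] by auto
      qed (use jk in simp)
    qed
    then show ?thesis using jk by simp
  qed
qed


text \<open>The parts are disjoint, so exchanging some of them leaves the arcs of the others in
  place.\<close>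

lemma swap_sequence_cycles:
  assumes "finite P" "disjoint P"
    and "\<And>C. C \<in> P \<Longrightarrow> exchangeable (C \<inter> parcs G) (C - parcs G) (w C)"
  shows "swap_sequence G (\<Sum>C\<in>P. w C) (G\<lparr>parcs := sym_diff (parcs G) (\<Union>P)\<rparr>)"
  using assms
proof (induction P rule: finite_induct)
  case empty
  then show ?case using swap_sequence.empty[of G] by simp
next
  case (insert C P)
  let ?H = "G\<lparr>parcs := sym_diff (parcs G) (\<Union>P)\<rparr>"
  have disj: "C \<inter> \<Union>P = {}"
    using insert.prems(1) insert.hyps(2) by (auto simp: disjoint_def)
  have "swap_sequence G (\<Sum>C\<in>P. w C) ?H"
    using insert.prems by (intro insert.IH) (auto simp: disjoint_def)
  moreover have "swap_sequence ?H (w C) (?H\<lparr>parcs := sym_diff (parcs G) (\<Union>(insert C P))\<rparr>)"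
  proof (rule exchangeableD)
    show "exchangeable (C \<inter> parcs G) (C - parcs G) (w C)" using insert.prems(2) by simp
    show "C \<inter> parcs G \<subseteq> parcs ?H" "(C - parcs G) \<inter> parcs ?H = {}"
      "sym_diff (parcs G) (\<Union>(insert C P)) = parcs ?H - C \<inter> parcs G \<union> (C - parcs G)"
      using disj by auto
  qed
  ultimately have "swap_sequence G ((\<Sum>C\<in>P. w C) + w C)
      (?H\<lparr>parcs := sym_diff (parcs G) (\<Union>(insert C P))\<rparr>)"
    by (rule swap_sequence_trans)
  then show ?case using insert.hyps by (simp add: add.commute)
qed

text \<open>The witness is \<open>k - 1\<close> for a cycle of length \<open>2 * k\<close>.
  Loopfreeness makes all pairs on the cycle chords.\<close>

lemma exchangeable_alternating_cycle:
  assumes cyc: "alternating_cycle (E - F) (F - E) C"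
    and loopfree: "\<And>e. e \<in> E \<union> F \<Longrightarrow> fst e \<noteq> snd e"
  obtains w where "exchangeable (C \<inter> E) (C - E) w" "card C = 2 * w + 2"
proof -
  obtain k x y where c: "cycle_vertices k x y" "fwd_arcs k x y \<subseteq> E - F" "bwd_arcs k x y \<subseteq> F - E"
      "C = fwd_arcs k x y \<union> bwd_arcs k x y"
    using cyc by (auto simp: alternating_cycle_def)
  have mem: "(x i, y i) \<in> E" "(x (Suc i), y i) \<in> F" if "i < k" for i
    using that c(2,3) by (auto simp: fwd_arcs_def bwd_arcs_def)
  have "exchangeable (fwd_arcs k x y) (bwd_arcs k x y) (k - 1)"
  proof (rule exchangeable_cycle[OF c(1)])
    show "x i \<noteq> y i" "x (Suc i) \<noteq> y i" if "i < k" for i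
      using loopfree[of "(x i, y i)"] loopfree[of "(x (Suc i), y i)"] mem[OF that] by auto
  qed
  moreover have "C \<inter> E = fwd_arcs k x y" "C - E = bwd_arcs k x y" using c(2-4) by auto
  moreover have "card C = 2 * (k - 1) + 2"
  proof -
    have "card C = card (fwd_arcs k x y) + card (bwd_arcs k x y)"
      unfolding c(4) using fwd_bwd_arcs_disjoint[OF c(1)]
      by (intro card_Un_disjoint) (auto simp: fwd_arcs_def bwd_arcs_def)
    then show ?thesis using c(1) card_fwd_arcs[OF c(1)] card_bwd_arcs[OF c(1)]
      by (auto simp: cycle_vertices_def)
  qed
  ultimately show ?thesis using that by simp
qed


section \<open>The effect of a swap on balanced partitions\<close>

text \<open>A cycle inside \<open>C\<close> already contributes two forward arcs.\<close>

lemma card_balanced_ge_2: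
  assumes "finite C" "C \<noteq> {}" "C \<subseteq> sym_diff E F" "balanced (sign_diff E F) C"
  shows "2 \<le> card C"
proof -
  obtain D where D: "D \<subseteq> C" "alternating_cycle (E - F) (F - E) D"
    using balanced_contains_alternating_cycle[OF assms] by metis
  then obtain k x y where c: "cycle_vertices k x y" "fwd_arcs k x y \<subseteq> D"
    by (auto simp: alternating_cycle_def)
  then have "card (fwd_arcs k x y) \<le> card C"
    using D(1) assms(1) by (intro card_mono) auto
  then show ?thesis using card_fwd_arcs[OF c(1)] c(1) by (simp add: cycle_vertices_def)
qed

text \<open>Each sign function vanishes off its own difference, so both are balanced on the union of
  the differences, where they telescope.\<close>

lemma balanced_sign_diff_trans:
  assumes fin: "finite (sym_diff E F)" "finite (sym_diff F K)"
    and bal: "balanced (sign_diff E F) (sym_diff E F)" "balanced (sign_diff F K) (sym_diff F K)"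
  shows "balanced (sign_diff E K) (sym_diff E K)"
proof -
  let ?U = "sym_diff E F \<union> sym_diff F K"
  have finU: "finite ?U" using fin by blast
  have "balanced (sign_diff E F) ?U"
    by (subst balanced_superset[OF finU, of "sym_diff E F"]) (use bal(1) in \<open>auto simp: sign_diff_def\<close>)
  moreover have "balanced (sign_diff F K) ?U"
    by (subst balanced_superset[OF finU, of "sym_diff F K"]) (use bal(2) in \<open>auto simp: sign_diff_def\<close>)
  ultimately have "balanced (\<lambda>e. sign_diff E F e + sign_diff F K e) ?U" by (rule balanced_add)
  then have "balanced (sign_diff E K) ?U"
    by (simp add: sign_diff_def[abs_def])
  then show ?thesis
    by (subst (asm) balanced_superset[OF finU, of "sym_diff E K"]) (auto simp: sign_diff_def)
qed

text \<open>All parts meeting the swapped arcs \<open>Q\<close> are merged with \<open>Q\<close> into a single part. At most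
  \<open>card (A \<inter> Q)\<close> parts are touched, and if the merged part vanishes then only half as many are.\<close>

lemma balanced_partition_swap:
  assumes fin: "finite (sym_diff E F)" "finite (sym_diff F K)"
    and P: "balanced_partition E F P"
    and bal: "balanced (sign_diff F K) (sym_diff F K)" and ne: "sym_diff F K \<noteq> {}"
  obtains P' where "balanced_partition E K P'"
    "card (sym_diff E K) + 2 * card P + 2 \<le> card (sym_diff E F) + card (sym_diff F K) + 2 * card P'"
proof -
  define A where "A = sym_diff E F"
  define Q where "Q = sym_diff F K"
  define A' where "A' = sym_diff E K"
  \<comment> \<open>\<open>T\<close> collects the touched parts, \<open>S\<close> is the union of
    the untouched ones, and \<open>N\<close> is the merged part.\<close>
  define T where "T = {C \<in> P. C \<inter> Q \<noteq> {}}"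
  define S where "S = \<Union>(P - T)"
  define N where "N = A' - S"
  define P' where "P' = (P - T) \<union> (if N = {} then {} else {N})"
  have A': "A' = (A - Q) \<union> (Q - A)" by (auto simp: A'_def A_def Q_def)
  have finA: "finite A" and finQ: "finite Q" and finA': "finite A'"
    using fin by (auto simp: A' A_def Q_def)
  have part: "\<Union>P = A" "disjoint P" "{} \<notin> P" and balP: "\<And>C. C \<in> P \<Longrightarrow> balanced (sign_diff E F) C"
    using P by (auto simp: balanced_partition_def partition_on_def A_def)
  have CA: "C \<subseteq> A" "finite C" if "C \<in> P" for C
    using that part(1) finA by (auto intro: finite_subset)
  have finP: "finite P" using part(1) finA by (simp add: finite_UnionD)
  have finT: "finite T" and TP: "T \<subseteq> P" using finP by (auto simp: T_def)
  have SQ: "S \<inter> Q = {}" and SA: "S \<subseteq> A" using CA(1) by (auto simp: S_def T_def)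
  have SA': "S \<subseteq> A'" using SQ SA by (auto simp: A')
  have disjPT: "disjoint (P - T)" using part(2) by (auto simp: disjoint_def)
  have "balanced (sign_diff E F) (\<Union>P)"
    using finP part(2) CA(2) balP by (intro balanced_Union) auto
  then have "balanced (sign_diff E F) (sym_diff E F)" unfolding part(1) A_def .
  then have balA': "balanced (sign_diff E K) A'"
    unfolding A'_def by (rule balanced_sign_diff_trans[OF fin _ bal])
  \<comment> \<open>Outside \<open>Q\<close> the sets \<open>F\<close> and \<open>K\<close> agree,
    so signs on untouched parts do not change.\<close>
  have balPT: "balanced (sign_diff E K) C" if "C \<in> P - T" for C
  proof -
    have "sign_diff E F e = sign_diff E K e" if "e \<in> C" for e
      using that \<open>C \<in> P - T\<close> by (auto simp: T_def Q_def sign_diff_def)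
    then show ?thesis using balanced_cong[of C] balP that by blast
  qed
  then have "balanced (sign_diff E K) S"
    unfolding S_def using finP disjPT CA(2) by (intro balanced_Union) auto
  then have balN: "balanced (sign_diff E K) N"
    unfolding N_def using finA' SA' balA' by (intro balanced_Diff)
  have NS: "N \<inter> S = {}" by (auto simp: N_def)
  have "partition_on A' P'"
    unfolding partition_on_def
  proof (intro conjI)
    show "\<Union>P' = A'" using SA' by (auto simp: P'_def N_def S_def)
    show "disjoint P'"
      unfolding P'_def using disjPT NS by (intro disjoint_union) (auto simp: S_def)
    show "{} \<notin> P'" using part(3) by (auto simp: P'_def)
  qed
  then have "balanced_partition E K P'"
    unfolding balanced_partition_def using balPT balN by (auto simp: A'_def P'_def split: if_splits)
  moreover have "card A' + 2 * card (A \<inter> Q) = card A + card Q"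
  proof -
    have "card A' = card (A - Q) + card (Q - A)"
      unfolding A' using finA finQ by (intro card_Un_disjoint) auto
    then show ?thesis using card_Int_Diff[OF finA, of Q] card_Int_Diff[OF finQ, of A]
      by (simp add: Int_commute)
  qed
  \<comment> \<open>Doubled and added to the previous equation, this gives the claim;
    \<open>card (A \<inter> Q)\<close> cancels.\<close>
  moreover have "card P + 1 \<le> card (A \<inter> Q) + card P'"
  proof -
    have cardP: "card P = card (P - T) + card T"
      using finT TP finP by (simp add: card_Diff_subset card_mono)
    show ?thesis
    proof (cases "N = {}")
      case False
      have "N \<notin> P - T" using False NS by (auto simp: S_def)
      then have "card P' = card (P - T) + 1" using False finP by (simp add: P'_def)
      \<comment> \<open>The touched parts meet \<open>Q\<close> in disjoint nonempty subsets of
        \<open>A \<inter> Q\<close>.\<close>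
      moreover have "card T \<le> card (A \<inter> Q)"
      proof -
        have "card T = (\<Sum>C\<in>T. 1)" by simp
        also have "\<dots> \<le> (\<Sum>C\<in>T. card (C \<inter> Q))"
          using finQ by (intro sum_mono) (auto simp: T_def Suc_le_eq card_gt_0_iff)
        also have "\<dots> = card (\<Union>C\<in>T. C \<inter> Q)"
          using finT finQ TP part(2)
          by (intro card_UN_disjoint[symmetric]) (auto simp: disjoint_def subset_iff)
        also have "\<dots> \<le> card (A \<inter> Q)"
          using finA TP CA(1) by (intro card_mono) auto
        finally show ?thesis .
      qed
      ultimately show ?thesis using cardP by simp
    next
      \<comment> \<open>Now \<open>Q\<close> lies in \<open>A\<close> and contains all touched
        parts. Each has at least two arcs and \<open>T\<close> is nonempty, so
        \<open>card T + 1 \<le> 2 * card T \<le> card Q\<close>.\<close>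
      case True
      then have "A' = S" using SA' by (auto simp: N_def)
      then have QA: "Q \<subseteq> A" and AQ: "A - Q \<subseteq> S" using SQ by (auto simp: A')
      have "C \<inter> C' = {}" if "C \<in> T" "C' \<in> P - T" for C C'
        using that TP disjointD[OF part(2), of C C'] by blast
      then have "\<Union>T \<inter> S = {}" unfolding S_def by blast
      then have "\<Union>T \<subseteq> Q" using AQ TP CA(1) by blast
      then have "card (\<Union>T) \<le> card Q" using finQ by (intro card_mono)
      moreover have "card (\<Union>T) = (\<Sum>C\<in>T. card C)"
        using part(2) TP CA(2) by (intro card_Union_disjoint) (auto intro: pairwise_subset)
      moreover have "(\<Sum>C\<in>T. 2) \<le> (\<Sum>C\<in>T. card C)"
      proof (rule sum_mono)
        fix C assume "C \<in> T"
        then have "C \<in> P" using TP by blast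
        then show "2 \<le> card C"
          using CA[of C] part(3) balP[of C] card_balanced_ge_2[of C E F] unfolding A_def by blast
      qed
      moreover have "T \<noteq> {}"
      proof -
        obtain e where "e \<in> Q" using ne by (auto simp: Q_def)
        then obtain C where "C \<in> P" "e \<in> C" using QA part(1) by blast
        then show ?thesis using \<open>e \<in> Q\<close> by (auto simp: T_def)
      qed
      then have "0 < card T" using finT by (simp add: card_gt_0_iff)
      moreover have "A \<inter> Q = Q" using QA by blast
      ultimately show ?thesis using cardP True by (simp add: P'_def)
    qed
  qed
  ultimately show ?thesis using that[of P'] by (simp add: A_def A'_def Q_def)
qed

text \<open>Each of the two tails and of the two heads carries one removed and one added arc. The
  count is \<open>2 * w + 2\<close> for weight \<open>w = 1\<close>.\<close>

lemma C4_swap_balanced: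
  assumes "C4_swap G H"
  shows "balanced (sign_diff (parcs G) (parcs H)) (sym_diff (parcs G) (parcs H))"
    "card (sym_diff (parcs G) (parcs H)) = 4"
proof -
  obtain x y z t where xyzt: "x \<noteq> z" "y \<noteq> t" "(x, y) \<in> parcs G" "(z, t) \<in> parcs G"
      "(x, t) \<notin> parcs G" "(z, y) \<notin> parcs G"
      and H: "parcs H = (parcs G - {(x, y), (z, t)}) \<union> {(x, t), (z, y)}"
    using assms by (auto simp: C4_swap_def)
  have Q: "sym_diff (parcs G) (parcs H) = {(x, y), (z, t), (x, t), (z, y)}"
    using xyzt unfolding H by auto
  have "sign_diff (parcs G) (parcs H) (x, y) = 1" "sign_diff (parcs G) (parcs H) (z, t) = 1"
    "sign_diff (parcs G) (parcs H) (x, t) = -1" "sign_diff (parcs G) (parcs H) (z, y) = -1"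
    unfolding sign_diff_eq H using xyzt by auto
  then show "balanced (sign_diff (parcs G) (parcs H)) (sym_diff (parcs G) (parcs H))"
    unfolding Q balanced_def using xyzt by (simp del: sum_of_bool_mult_eq)
  show "card (sym_diff (parcs G) (parcs H)) = 4"
    unfolding Q using xyzt by simp
qed

text \<open>Each of the three vertices is the tail, and also the head, of one removed and one added
  arc; here \<open>w = 2\<close>.\<close>

lemma triangular_C6_swap_balanced:
  assumes "triangular_C6_swap G H"
  shows "balanced (sign_diff (parcs G) (parcs H)) (sym_diff (parcs G) (parcs H))"
    "card (sym_diff (parcs G) (parcs H)) = 6"
proof -
  obtain x y z where xyz: "x \<noteq> y" "y \<noteq> z" "x \<noteq> z"
      "(x, y) \<in> parcs G" "(y, z) \<in> parcs G" "(z, x) \<in> parcs G"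
      "(y, x) \<notin> parcs G" "(z, y) \<notin> parcs G" "(x, z) \<notin> parcs G"
      and H: "parcs H = (parcs G - {(x, y), (y, z), (z, x)}) \<union> {(y, x), (z, y), (x, z)}"
    using assms by (auto simp: triangular_C6_swap_def)
  have Q: "sym_diff (parcs G) (parcs H) = {(x, y), (y, z), (z, x), (y, x), (z, y), (x, z)}"
    using xyz unfolding H by auto
  have "sign_diff (parcs G) (parcs H) (x, y) = 1" "sign_diff (parcs G) (parcs H) (y, z) = 1"
    "sign_diff (parcs G) (parcs H) (z, x) = 1" "sign_diff (parcs G) (parcs H) (y, x) = -1"
    "sign_diff (parcs G) (parcs H) (z, y) = -1" "sign_diff (parcs G) (parcs H) (x, z) = -1"
    unfolding sign_diff_eq H using xyz by auto
  then show "balanced (sign_diff (parcs G) (parcs H)) (sym_diff (parcs G) (parcs H))"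
    unfolding Q balanced_def using xyz by (simp del: sum_of_bool_mult_eq)
  show "card (sym_diff (parcs G) (parcs H)) = 6"
    unfolding Q using xyz by simp
qed

text \<open>Along the sequence, half the size of the difference minus the number of parts never
  exceeds the accumulated weight.\<close>

lemma swap_sequence_lower_bound:
  assumes "swap_sequence G w H"
  obtains P where "balanced_partition (parcs G) (parcs H) P"
    "card (sym_diff (parcs G) (parcs H)) \<le> 2 * w + 2 * card P"
proof -
  have step: "\<exists>P. finite (sym_diff (parcs G) (parcs K)) \<and> balanced_partition (parcs G) (parcs K) P \<and>
      card (sym_diff (parcs G) (parcs K)) \<le> 2 * (w + v) + 2 * card P"
    if fin: "finite (sym_diff (parcs G) (parcs H))" and P: "balanced_partition (parcs G) (parcs H) P"
      and le: "card (sym_diff (parcs G) (parcs H)) \<le> 2 * w + 2 * card P"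
      and bal: "balanced (sign_diff (parcs H) (parcs K)) (sym_diff (parcs H) (parcs K))"
      and card: "card (sym_diff (parcs H) (parcs K)) = 2 * v + 2"
    for G H K :: "'a pair_pre_digraph" and P v w
  proof -
    \<comment> \<open>Infinite sets have cardinality 0, so positivity yields both finiteness and
      nonemptiness.\<close>
    have pos: "card (sym_diff (parcs H) (parcs K)) > 0" using card by linarith
    then have fin': "finite (sym_diff (parcs H) (parcs K))" by (rule card_ge_0_finite)
    have ne: "sym_diff (parcs H) (parcs K) \<noteq> {}" using pos by (metis card.empty less_irrefl)
    obtain P' where P': "balanced_partition (parcs G) (parcs K) P'"
      "card (sym_diff (parcs G) (parcs K)) + 2 * card P + 2 \<le>
        card (sym_diff (parcs G) (parcs H)) + card (sym_diff (parcs H) (parcs K)) + 2 * card P'"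
      by (rule balanced_partition_swap[OF fin fin' P bal ne])
    have "sym_diff (parcs G) (parcs K) \<subseteq> sym_diff (parcs G) (parcs H) \<union> sym_diff (parcs H) (parcs K)"
      by blast
    then have "finite (sym_diff (parcs G) (parcs K))"
      using fin fin' by (meson finite_UnI finite_subset)
    moreover have "card (sym_diff (parcs G) (parcs K)) \<le> 2 * (w + v) + 2 * card P'"
      using P'(2) le card by simp
    ultimately show ?thesis using P'(1) by blast
  qed
  \<comment> \<open>The invariant carries finiteness of the difference, as the graphs here are not
    assumed finite.\<close>
  have "\<exists>P. finite (sym_diff (parcs G) (parcs H)) \<and> balanced_partition (parcs G) (parcs H) P \<and>
      card (sym_diff (parcs G) (parcs H)) \<le> 2 * w + 2 * card P"
    using assms
  proof (induction rule: swap_sequence.induct)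
    case (empty G)
    show ?case by (intro exI[of _ "{}"]) (simp add: balanced_partition_def partition_on_def)
  next
    case (C4 G w H K)
    then show ?case using C4_swap_balanced[OF C4.hyps(2)] step[of G H _ w K 1] by auto
  next
    case (C6 G w H K)
    then show ?case using triangular_C6_swap_balanced[OF C6.hyps(2)] step[of G H _ w K 2] by auto
  qed
  then show ?thesis using that by blast
qed


section \<open>The swap distance\<close>

text \<open>Common arcs have sign 0, so over the union of the arc sets the signed counts at a vertex
  are differences of its degrees.\<close>

lemma balanced_realizations:
  assumes "realization G V dout din" "realization H V dout din"
  shows "balanced (sign_diff (parcs G) (parcs H)) (sym_diff (parcs G) (parcs H))"
proof -
  interpret G: pair_digraph G using assms(1) by (simp add: realization_def)
  interpret H: pair_digraph H using assms(2) by (simp add: realization_def)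
  let ?E = "parcs G" and ?F = "parcs H"
  have fin: "finite ?E" "finite ?F" by (rule G.pair_finite_arcs H.pair_finite_arcs)+
  have V: "pverts G = V" "pverts H = V" using assms by (simp_all add: realization_def)
  have sum_eq: "(\<Sum>e\<in>?E \<union> ?F. of_bool (\<pi> e = v) * sign_diff ?E ?F e) =
      int (card {e \<in> ?E. \<pi> e = v}) - int (card {e \<in> ?F. \<pi> e = v})" for \<pi> :: "'a \<times> 'a \<Rightarrow> 'a" and v
  proof -
    have count: "(\<Sum>e\<in>?E \<union> ?F. of_bool (\<pi> e = v \<and> e \<in> X)) = int (card {e \<in> X. \<pi> e = v})"
      if "X \<subseteq> ?E \<union> ?F" for X
    proof -
      have "(\<Sum>e\<in>?E \<union> ?F. of_bool (\<pi> e = v \<and> e \<in> X)) = (\<Sum>e\<in>{e \<in> X. \<pi> e = v}. 1 :: int)"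
        using fin that by (intro sum.mono_neutral_cong_right) auto
      then show ?thesis by simp
    qed
    have "(\<Sum>e\<in>?E \<union> ?F. of_bool (\<pi> e = v) * sign_diff ?E ?F e) =
        (\<Sum>e\<in>?E \<union> ?F. of_bool (\<pi> e = v \<and> e \<in> ?E) - of_bool (\<pi> e = v \<and> e \<in> ?F))"
      by (intro sum.cong) (auto simp: sign_diff_def)
    then show ?thesis by (simp only: sum_subtractf count[OF Un_upper1] count[OF Un_upper2])
  qed
  have "card {e \<in> ?E. fst e = v} = card {e \<in> ?F. fst e = v} \<and>
      card {e \<in> ?E. snd e = v} = card {e \<in> ?F. snd e = v}" for v
  proof (cases "v \<in> V")
    case True
    then show ?thesis using assms
      by (simp add: realization_def in_degree_def out_degree_def in_arcs_def out_arcs_def)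
  next
    \<comment> \<open>Degrees are prescribed on \<open>V\<close> only, but outside \<open>V\<close>
      there are no arcs.\<close>
    case False
    then have "{e \<in> ?E. fst e = v} = {}" "{e \<in> ?F. fst e = v} = {}"
      "{e \<in> ?E. snd e = v} = {}" "{e \<in> ?F. snd e = v} = {}"
      using V G.wellformed' H.wellformed' by auto
    then show ?thesis by (simp only:)
  qed
  then have "balanced (sign_diff ?E ?F) (?E \<union> ?F)"
    unfolding balanced_def sum_eq by simp
  then show ?thesis
    by (subst (asm) balanced_superset[of _ "sym_diff ?E ?F"]) (use fin in \<open>auto simp: sign_diff_def\<close>)
qed

theorem theorem5p4:
  fixes V :: "'a set" and dout din :: "'a \<Rightarrow> nat" and G1 G2 :: "'a pair_pre_digraph"
  assumes "realization G1 V dout din"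
    and "realization G2 V dout din"
  shows "ereal_of_enat (dist_d G1 G2) = ereal (half_hamming G1 G2 - real (maxC_d G1 G2))"
proof -
  interpret G1: pair_digraph G1 using assms(1) by (simp add: realization_def)
  interpret G2: pair_digraph G2 using assms(2) by (simp add: realization_def)
  let ?E = "parcs G1" and ?F = "parcs G2"
  have fin: "finite ?E" "finite ?F" by (rule G1.pair_finite_arcs G2.pair_finite_arcs)+
  obtain P where P: "balanced_partition ?E ?F P"
      and max: "\<And>Q. balanced_partition ?E ?F Q \<Longrightarrow> card Q \<le> card P"
    using max_balanced_partition_exists[OF fin balanced_realizations[OF assms]] by blast
  have maxC: "maxC_d G1 G2 = card P" by (rule maxC_d_eq[OF fin P max])
  have part: "\<Union>P = sym_diff ?E ?F" "disjoint P"
    using P by (auto simp: balanced_partition_def partition_on_def)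
  have finP: "finite P" and finC: "\<And>C. C \<in> P \<Longrightarrow> finite C"
    using part(1) fin by (auto intro: finite_UnionD finite_subset[OF Union_upper])
  have "\<exists>w. exchangeable (C \<inter> ?E) (C - ?E) w \<and> card C = 2 * w + 2" if "C \<in> P" for C
    using exchangeable_alternating_cycle[OF max_balanced_partition_cycles[OF fin P max that]]
      G1.pair_no_loops G2.pair_no_loops by (metis UnE)
  then obtain w where w: "\<And>C. C \<in> P \<Longrightarrow> exchangeable (C \<inter> ?E) (C - ?E) (w C)"
      "\<And>C. C \<in> P \<Longrightarrow> card C = 2 * w C + 2"
    by metis
  \<comment> \<open>Summed over the parts, the weights make up half the difference minus the number
    of parts.\<close>
  have "card (sym_diff ?E ?F) = (\<Sum>C\<in>P. card C)"
    unfolding part(1)[symmetric] by (rule card_Union_disjoint[OF part(2) finC])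
  also have "\<dots> = (\<Sum>C\<in>P. 2 * w C + 2)" using w(2) by (intro sum.cong) auto
  also have "\<dots> = 2 * (\<Sum>C\<in>P. w C) + 2 * card P"
    unfolding sum.distrib by (simp add: sum_distrib_left)
  finally have card: "card (sym_diff ?E ?F) = 2 * (\<Sum>C\<in>P. w C) + 2 * card P" .
  have "swap_sequence G1 (\<Sum>C\<in>P. w C) (G1\<lparr>parcs := sym_diff ?E (\<Union>P)\<rparr>)"
    by (rule swap_sequence_cycles[OF finP part(2) w(1)])
  moreover have "sym_diff ?E (\<Union>P) = ?F" using part(1) by blast
  \<comment> \<open>Both graphs have vertex set \<open>V\<close>, so the arcs determine
    them.\<close>
  moreover have "G1\<lparr>parcs := ?F\<rparr> = G2"
    using assms by (cases G1; cases G2) (simp add: realization_def)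
  ultimately have swaps: "swap_sequence G1 (\<Sum>C\<in>P. w C) G2" by simp
  \<comment> \<open>The partition obtained from a sequence of weight \<open>v\<close> has at most
    \<open>card P\<close> parts, which bounds \<open>v\<close> from below.\<close>
  have least: "(\<Sum>C\<in>P. w C) \<le> v" if v: "swap_sequence G1 v G2" for v
  proof -
    obtain Q where "balanced_partition ?E ?F Q" "card (sym_diff ?E ?F) \<le> 2 * v + 2 * card Q"
      by (rule swap_sequence_lower_bound[OF v])
    with max[of Q] card show ?thesis by linarith
  qed
  have "dist_d G1 G2 = enat (\<Sum>C\<in>P. w C)"
    unfolding dist_d_def
    by (rule antisym) (use swaps least in \<open>auto intro!: INF_lower2 INF_greatest\<close>)
  moreover have "half_hamming G1 G2 - real (maxC_d G1 G2) = real (\<Sum>C\<in>P. w C)"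
    unfolding half_hamming_def card maxC by (simp add: add_divide_distrib)
  ultimately show ?thesis by (simp only: ereal_of_enat_simps)
qed

end
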